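(* Let $f:\mathbb{R}\to\mathbb{R}$ be any sufficiently smooth function. Then $$\Lambda[f\,\Lambda f](0)+f(0)f''(0)=\frac12(\Lambda f(0))^2-\frac12(f'(0))^2-\left\|\frac{f(x)-f(0)}{x}\right\|_{\dot H^{1/2}}^2 .$$
   Context: $\Lambda=(-\Delta)^{1/2}$ on $\mathbb{R}$; equivalently $\Lambda f=-H\partial_x f$, where $H$ is the Hilbert transform $Hf(x)=\frac1\pi\,\mathrm{p.v.}\int_{\mathbb{R}}\frac{f(y)}{y-x}\,dy$. $\Lambda[f\,\Lambda f](0)$ denotes the value at $x=0$ of $\Lambda$ applied to the product $f\,\Lambda f$. $\|\cdot\|_{\dot H^{1/2}}$ is the homogeneous Sobolev seminorm of order $1/2$ on $\mathbb{R}$, with $\|g\|_{\dot H^{1/2}}^2=\int_{\mathbb{R}} g\,\Lambda g\,dx$; in the identity it is applied to the function $g(x)=\frac{f(x)-f(0)}{x}$.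
   Formalization: The last term is proved with a factor 1/π, since the printed identity fails for f(x)=x/(1+x²) when ‖g‖² = ∫gΛg dx; "sufficiently smooth" is taken as C³ with f, f', f'', f''' bounded. *)

theory Defs
  imports "HOL-Analysis.Analysis"
begin

text \<open>The class $C^k_b$ of functions that are \<open>k\<close> times continuously differentiable with
  \<open>f\<close> and all derivatives up to order \<open>k\<close> bounded. Boundedness of \<open>f\<close> is what makes the
  nonlocal operators below converge at infinity; no decay is needed, so Sobolev, Schwartz and
  smooth periodic functions are all covered.\<close>

definition Cb :: "nat \<Rightarrow> (real \<Rightarrow> real) \<Rightarrow> bool" where
  "Cb k f \<longleftrightarrow>
     (\<forall>j<k. \<forall>x. (deriv ^^ j) f differentiable (at x)) \<and>
     continuous_on UNIV ((deriv ^^ k) f) \<and>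
     (\<forall>j\<le>k. bounded (range ((deriv ^^ j) f)))"

text \<open>The principal value is taken both at the singularity \<open>y = x\<close> and at infinity, as a joint
  limit \<open>\<epsilon> \<rightarrow> 0+\<close>, \<open>R \<rightarrow> \<infinity>\<close>. The kernel \<open>1 / (y - x)\<close> is the negative of the other common
  convention.\<close>

definition hilbert :: "(real \<Rightarrow> real) \<Rightarrow> real \<Rightarrow> real" where
  "hilbert f x = 1 / pi *
     Lim (at_right 0 \<times>\<^sub>F at_top)
       (\<lambda>(\<epsilon>, R). LBINT y:{y. \<epsilon> < \<bar>y - x\<bar> \<and> \<bar>y - x\<bar> < R}. f y / (y - x))"

definition Lam :: "(real \<Rightarrow> real) \<Rightarrow> real \<Rightarrow> real" where
  "Lam f x = - hilbert (deriv f) x"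

text \<open>The integral of \<open>g * Lam g\<close> is taken against plain Lebesgue measure, so that its
  value is $\frac{1}{2\pi}\iint \frac{(g(x)-g(y))^2}{(x-y)^2}\,dx\,dy$. In this normalisation
  the seminorm of the difference quotient enters the identity with the factor \<open>1 / pi\<close>; for
  example, \<open>f x = x / (1 + x\<^sup>2)\<close> has $\Lambda[f \Lambda f](0) = -3/4$, $\Lambda f(0) = 0$,
  $f(0) = 0$, $f'(0) = 1$, and $g(x) = 1/(1+x^2)$ has $\int g\,\Lambda g\,dx = \pi/4$.\<close>

definition hdot_half :: "(real \<Rightarrow> real) \<Rightarrow> real" where
  "hdot_half g = sqrt (LBINT x. g x * Lam g x)"

text \<open>The function $x \mapsto (f(x) - f(0))/x$, with its removable singularity at 0 filled in.\<close>

definition diffquot :: "(real \<Rightarrow> real) \<Rightarrow> real \<Rightarrow> real" where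
  "diffquot f x = (if x = 0 then deriv f 0 else (f x - f 0) / x)"

end

theory Submission
  imports Defs "HOL-Real_Asymp.Real_Asymp"
begin

text \<open>
  Integration by parts turns \<open>Lam v x\<close> into $\frac{1}{2\pi}\int_{\mathbb{R}} (2v(x)-v(x+t)-v(x-t))\,t^{-2}\,dt$.
  Write $L = \Lambda f$ and $f(x) = f(0) + x\,g(x)$. The second difference of $fL$ at $0$ splits into
  $f(0)$ times that of $L$, which yields $f(0)\,\Lambda\Lambda f(0) = -f(0) f''(0)$, and the odd part of
  $gL$. For the latter, the commutator identity $L = x\Lambda g - Hg$ reduces the claim to Cotlar's
  identity $2H(gHg) = (Hg)^2 - g^2$ at $0$. Both $\Lambda\Lambda f = -f''$ and Cotlar's identity are
  first proved exactly with $1/x$ replaced by $k(x) = x/(x^2+d^2)$, and then $d \to 0$. With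
  $p(x) = d/(x^2+d^2)$, Cotlar's identity comes from symmetrising a double integral by means of
  $(k(x)-k(y))/(y-x) = k(x)k(y) - p(x)p(y)$.
\<close>

section \<open>The fractional Laplacian as a second-difference integral\<close>

text \<open>For d > 0 they are dominated by products of Poisson kernels, possibly sheared, so the
  algebra is exact and only single integrals have to pass to the limit. Both regularised identities
  come from complex analysis. With z = x + i d one has 1/z = k(x) - i p(x). The kernel relation
  behind Cotlar's identity is the real part of 1/z - 1/w = (w - z)/(z w), and the kernel that
  replaces 1/x^2 in the proof of \<Lambda>\<Lambda>f = -f'' is Re z^(-2), which \<Lambda> maps to
  p''. The factor 1/pi in front of the seminorm is 2/(2 pi): the 2 comes from folding a principal
  value onto its odd part, the 1/(2 pi) from the second-difference form of \<Lambda>.\<close>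

definition D2 :: "(real \<Rightarrow> real) \<Rightarrow> real \<Rightarrow> real \<Rightarrow> real" where
  "D2 v x t = 2 * v x - v (x + t) - v (x - t)"

text \<open>No principal value is left: the second difference is O(t^2) when \<open>v\<close> has a
  Lipschitz derivative and bounded when \<open>v\<close> is, so the integral then converges
  absolutely. Each pair t, -t is counted twice, hence 1/(2 pi) instead of 1/pi.\<close>

definition LamI :: "(real \<Rightarrow> real) \<Rightarrow> real \<Rightarrow> real" where
  "LamI v x = 1 / (2 * pi) * (LINT t|lborel. D2 v x t / t\<^sup>2)"

lemma D2_minus [simp]: "D2 v x (- t) = D2 v x t"
  by (simp add: D2_def)

lemma integral_lborel_shift:
  fixes u :: "real \<Rightarrow> 'a::{banach, second_countable_topology}"
  shows "(LINT x|lborel. u (x + t)) = (LINT x|lborel. u x)"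
  using lborel_integral_real_affine[of 1 u t] by (simp add: add.commute)

lemma integrable_lborel_shift:
  fixes u :: "real \<Rightarrow> 'a::{banach, second_countable_topology}"
  shows "integrable lborel (\<lambda>x. u (x + t)) \<longleftrightarrow> integrable lborel u"
  using lborel_integrable_real_affine_iff[of 1 u t] by (simp add: add.commute)

lemma integral_lborel_reflect:
  fixes u :: "real \<Rightarrow> 'a::{banach, second_countable_topology}"
  shows "(LINT x|lborel. u (- x)) = (LINT x|lborel. u x)"
  using lborel_integral_real_affine[of "-1" u 0] by simp

lemma integrable_lborel_reflect:
  fixes u :: "real \<Rightarrow> 'a::{banach, second_countable_topology}"
  shows "integrable lborel (\<lambda>x. u (- x)) \<longleftrightarrow> integrable lborel u"
  using lborel_integrable_real_affine_iff[of "-1" u 0] by simp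

text \<open>The region is an open interval of radius R minus a closed one of radius \<epsilon>, so
  the joint limit splits into two one-parameter limits, each by dominated convergence. With
  \<open>\<psi> 0 = 0\<close> the integrand over the shrinking interval tends to 0 at every
  point.\<close>

lemma tendsto_punctured_integral:
  fixes \<psi> :: "real \<Rightarrow> real"
  assumes int: "integrable lborel \<psi>" and 0: "\<psi> 0 = 0"
  shows "((\<lambda>(\<epsilon>, R). LINT t|lborel. indicator {t. \<epsilon> < \<bar>t\<bar> \<and> \<bar>t\<bar> < R} t * \<psi> t)
    \<longlongrightarrow> (LINT t|lborel. \<psi> t)) (at_right 0 \<times>\<^sub>F at_top)"
proof -
  have m[measurable]: "\<psi> \<in> borel_measurable borel" using borel_measurable_integrable[OF int] by simp
  have int': "integrable lborel (\<lambda>t. indicator A t * \<psi> t)" if "A \<in> sets borel" for A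
    using integrable_mult_indicator[of A lborel \<psi>] int that by simp
  define P where "P R = (LINT t|lborel. indicator {-R<..<R} t * \<psi> t)" for R :: real
  define Q where "Q e = (LINT t|lborel. indicator {-e..e} t * \<psi> t)" for e :: real
  have P: "(P \<longlongrightarrow> (LINT t|lborel. \<psi> t)) at_top"
    unfolding P_def
  proof (rule integral_dominated_convergence_at_top[where w="\<lambda>t. \<bar>\<psi> t\<bar>"])
    show "AE x in lborel. ((\<lambda>R. indicator {-R<..<R} x * \<psi> x) \<longlongrightarrow> \<psi> x) at_top"
    proof (rule AE_I2)
      fix x :: real
      have "eventually (\<lambda>R. indicator {-R<..<R} x * \<psi> x = \<psi> x) at_top"
        using eventually_gt_at_top[of "\<bar>x\<bar>"] by eventually_elim (auto simp: indicator_def)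
      then show "((\<lambda>R. indicator {-R<..<R} x * \<psi> x) \<longlongrightarrow> \<psi> x) at_top"
        by (rule tendsto_eventually)
    qed
  qed (use int in \<open>auto simp: indicator_def\<close>)
  have Q: "(Q \<longlongrightarrow> 0) (at_right 0)"
  proof (rule tendsto_at_right_sequentially[of 0 1])
    fix S :: "nat \<Rightarrow> real"
    assume S: "\<And>n. 0 < S n" "\<And>n. S n < 1" "decseq S" "S \<longlonglongrightarrow> 0"
    have "(\<lambda>n. Q (S n)) \<longlonglongrightarrow> (LINT t|(lborel::real measure). 0)"
      unfolding Q_def
    proof (rule integral_dominated_convergence[where w="\<lambda>t. \<bar>\<psi> t\<bar>"])
      show "AE x in lborel. (\<lambda>n. indicator {- S n..S n} x * \<psi> x) \<longlonglongrightarrow> 0"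
      proof (rule AE_I2)
        fix x :: real
        show "(\<lambda>n. indicator {- S n..S n} x * \<psi> x) \<longlonglongrightarrow> 0"
        proof (cases "x = 0")
          case False
          then have "eventually (\<lambda>n. S n < \<bar>x\<bar>) sequentially"
            using S(4) by (intro order_tendstoD(2)[of S 0]) auto
          then have "eventually (\<lambda>n. indicator {- S n..S n} x * \<psi> x = 0) sequentially"
            by eventually_elim (auto simp: indicator_def)
          then show ?thesis by (rule tendsto_eventually)
        qed (simp add: 0)
      qed
    qed (use int in \<open>auto simp: indicator_def\<close>)
    then show "(\<lambda>n. Q (S n)) \<longlonglongrightarrow> 0" by simp
  qed simp
  have "((\<lambda>z. P (snd z) - Q (fst z)) \<longlongrightarrow> (LINT t|lborel. \<psi> t) - 0) (at_right 0 \<times>\<^sub>F at_top)"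
    by (intro tendsto_diff filterlim_compose[OF P filterlim_snd] filterlim_compose[OF Q filterlim_fst])
  moreover have "eventually (\<lambda>z. P (snd z) - Q (fst z)
      = (case z of (\<epsilon>, R) \<Rightarrow> LINT t|lborel. indicator {t. \<epsilon> < \<bar>t\<bar> \<and> \<bar>t\<bar> < R} t * \<psi> t))
      (at_right (0::real) \<times>\<^sub>F at_top)"
  proof -
    have "eventually (\<lambda>z. fst z < 1 \<and> snd z > 1) (at_right (0::real) \<times>\<^sub>F (at_top :: real filter))"
      by (intro eventually_prodI[of "\<lambda>e. e < 1" _ "\<lambda>R. R > 1", simplified fst_conv] eventually_gt_at_top)
         (auto simp: eventually_at_right_field intro!: exI[of _ 1])
    then show ?thesis
    proof eventually_elim
      case (elim z)
      then have "indicator {-snd z<..<snd z} t * \<psi> t - indicator {-fst z..fst z} t * \<psi> t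
        = indicator {t. fst z < \<bar>t\<bar> \<and> \<bar>t\<bar> < snd z} t * \<psi> t" for t
        by (auto simp: indicator_def abs_if split: if_splits)
      then show ?case
        unfolding P_def Q_def
        by (subst Bochner_Integration.integral_diff[symmetric]) (auto simp: case_prod_beta intro!: int')
    qed
  qed
  ultimately show ?thesis
    by (simp add: tendsto_cong)
qed

text \<open>Integration by parts on each half line away from 0. The boundary function \<Phi>
  vanishes at infinity because \<open>v\<close> is bounded, and at 0 because \<open>D2 v x t\<close>
  is o(t).\<close>

lemma Lam_eq_LamI:
  assumes der: "\<And>x. (v has_real_derivative v1 x) (at x)" and cont: "continuous_on UNIV v1"
    and bd: "\<And>x. \<bar>v x\<bar> \<le> A"
    and int: "integrable lborel (\<lambda>t. D2 v x t / t\<^sup>2)"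
  shows "Lam v x = LamI v x"
proof -
  define \<psi> where "\<psi> t = D2 v x t / t\<^sup>2" for t
  define \<Phi> where "\<Phi> t = - D2 v x t / t" for t
  define \<phi> where "\<phi> t = (v1 (x + t) - v1 (x - t)) / t" for t
  have int\<psi>: "integrable lborel \<psi>" using int by (simp add: \<psi>_def[abs_def])
  have dv: "deriv v = v1" using der by (auto intro!: DERIV_imp_deriv)
  have cv: "continuous_on S v" for S
    using der by (meson DERIV_continuous continuous_at_imp_continuous_on)
  have c1: "continuous_on S (\<lambda>t. v (x + t))" "continuous_on S (\<lambda>t. v (x - t))"
    "continuous_on S (\<lambda>t. v1 (x + t))" "continuous_on S (\<lambda>t. v1 (x - t))" for S
    by (auto intro!: continuous_on_compose2[OF cv[of UNIV]] continuous_on_compose2[OF cont] continuous_intros)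
  \<comment> \<open>\<phi> is the folded Hilbert integrand of the derivative, \<psi> the target
    integrand; their sum is an exact derivative.\<close>
  have D\<Phi>: "(\<Phi> has_real_derivative \<phi> t + \<psi> t) (at t)" if "t \<noteq> 0" for t
    unfolding \<Phi>_def \<phi>_def \<psi>_def D2_def using that
    by (auto intro!: derivative_eq_intros DERIV_chain'[OF _ der, THEN DERIV_cong]
         simp: power2_eq_square field_simps)
  have FTC: "has_bochner_integral lborel (\<lambda>t. indicator {a..b} t *\<^sub>R (\<phi> t + \<psi> t)) (\<Phi> b - \<Phi> a)"
    if "a \<le> b" "0 \<notin> {a..b}" for a b
  proof (rule has_bochner_integral_FTC_Icc[OF that(1)])
    show "(\<Phi> has_vector_derivative \<phi> t + \<psi> t) (at t within {a..b})" if "a \<le> t" "t \<le> b" for t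
      using D\<Phi>[of t] that \<open>0 \<notin> {a..b}\<close>
      by (intro has_field_derivative_at_within[THEN has_real_derivative_iff_has_vector_derivative[THEN iffD1]]) auto
    show "continuous_on {a..b} (\<lambda>t. \<phi> t + \<psi> t)"
      unfolding \<phi>_def \<psi>_def D2_def using that by (auto intro!: continuous_intros c1)
  qed
  \<comment> \<open>Reflection pairs t with -t. Since \<Phi> is odd, both half lines contribute the
    same boundary terms; after halving, the factor 1/2 survives only in front of \<psi>.\<close>
  have main: "(LBINT y:{y. \<epsilon> < \<bar>y - x\<bar> \<and> \<bar>y - x\<bar> < R}. deriv v y / (y - x))
    = \<Phi> R - \<Phi> \<epsilon> - 1/2 * (LINT t|lborel. indicator {t. \<epsilon> < \<bar>t\<bar> \<and> \<bar>t\<bar> < R} t * \<psi> t)"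
    if "0 < \<epsilon>" "\<epsilon> < R" for \<epsilon> R
  proof -
    let ?A = "{t. \<epsilon> < \<bar>t\<bar> \<and> \<bar>t\<bar> < R}"
    define u where "u t = indicator ?A t * (v1 (x + t) / t)" for t
    have "(LBINT y:{y. \<epsilon> < \<bar>y - x\<bar> \<and> \<bar>y - x\<bar> < R}. deriv v y / (y - x)) = (LINT t|lborel. u t)"
      unfolding set_lebesgue_integral_def
      by (subst lborel_integral_real_affine[of 1 _ x])
         (auto simp: dv u_def indicator_def intro!: Bochner_Integration.integral_cong)
    moreover have u_int: "integrable lborel u"
    proof -
      have "integrable lborel (\<lambda>t. indicator {\<epsilon>..R} t *\<^sub>R (v1 (x + t) / t))"
        "integrable lborel (\<lambda>t. indicator {-R..-\<epsilon>} t *\<^sub>R (v1 (x + t) / t))"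
        using that by (auto intro!: borel_integrable_atLeastAtMost'[unfolded set_integrable_def] continuous_intros c1 simp del: real_scaleR_def)
      from integrable_mult_indicator[of ?A, OF _ Bochner_Integration.integrable_add[OF this]]
      have "integrable lborel (\<lambda>t. indicator ?A t *\<^sub>R (indicator {\<epsilon>..R} t *\<^sub>R (v1 (x + t) / t)
           + indicator {-R..-\<epsilon>} t *\<^sub>R (v1 (x + t) / t)))"
        by simp
      then show ?thesis
        by (rule Bochner_Integration.integrable_cong[THEN iffD1, rotated -1])
           (use that in \<open>auto simp: u_def indicator_def abs_if\<close>)
    qed
    have "2 * (LINT t|lborel. u t) = (LINT t|lborel. u t + u (-t))"
      using u_int integral_lborel_reflect[of u] integrable_lborel_reflect[of u]
      by simp
    moreover have "(LINT t|lborel. u t + u (-t)) = (LINT t|lborel. indicator ?A t * \<phi> t)"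
      by (intro Bochner_Integration.integral_cong) (auto simp: u_def \<phi>_def indicator_def diff_divide_distrib)
    moreover have "(LINT t|lborel. indicator ?A t * \<phi> t)
      = 2 * (\<Phi> R - \<Phi> \<epsilon>) - (LINT t|lborel. indicator ?A t * \<psi> t)"
    proof -
      have ip: "integrable lborel (\<lambda>t. indicator ?A t * \<psi> t)"
        using integrable_mult_indicator[of ?A lborel \<psi>] int\<psi> by simp
      have "has_bochner_integral lborel (\<lambda>t. indicator {\<epsilon>..R} t *\<^sub>R (\<phi> t + \<psi> t)
          + indicator {-R..-\<epsilon>} t *\<^sub>R (\<phi> t + \<psi> t)) (\<Phi> R - \<Phi> \<epsilon> + (\<Phi> (-\<epsilon>) - \<Phi> (-R)))"
        using that by (intro has_bochner_integral_add FTC) auto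
      also have "\<Phi> R - \<Phi> \<epsilon> + (\<Phi> (-\<epsilon>) - \<Phi> (-R)) = 2 * (\<Phi> R - \<Phi> \<epsilon>)"
        by (simp add: \<Phi>_def)
      finally have *: "has_bochner_integral lborel (\<lambda>t. indicator {\<epsilon>..R} t *\<^sub>R (\<phi> t + \<psi> t)
          + indicator {-R..-\<epsilon>} t *\<^sub>R (\<phi> t + \<psi> t)) (2 * (\<Phi> R - \<Phi> \<epsilon>))" .
      have m: "(\<lambda>t. indicator ?A t * (\<phi> t + \<psi> t)) \<in> borel_measurable lborel"
      proof -
        have [measurable]: "v \<in> borel_measurable borel" "v1 \<in> borel_measurable borel"
          using cv cont by (auto intro: borel_measurable_continuous_onI)
        show ?thesis unfolding \<phi>_def \<psi>_def D2_def by measurable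
      qed
      \<comment> \<open>The closed intervals of the fundamental theorem and the open set differ in
        the four endpoints only.\<close>
      have ae: "AE t in lborel. indicator {\<epsilon>..R} t *\<^sub>R (\<phi> t + \<psi> t)
          + indicator {-R..-\<epsilon>} t *\<^sub>R (\<phi> t + \<psi> t) = indicator ?A t * (\<phi> t + \<psi> t)"
        using AE_lborel_singleton[of \<epsilon>] AE_lborel_singleton[of R]
          AE_lborel_singleton[of "-\<epsilon>"] AE_lborel_singleton[of "-R"]
        by eventually_elim (use that in \<open>auto simp: indicator_def abs_if\<close>)
      have "has_bochner_integral lborel (\<lambda>t. indicator ?A t * (\<phi> t + \<psi> t)) (2 * (\<Phi> R - \<Phi> \<epsilon>))"
        using has_bochner_integralI_AE[OF * m ae] .
      then have "has_bochner_integral lborel (\<lambda>t. indicator ?A t * (\<phi> t + \<psi> t) - indicator ?A t * \<psi> t)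
          (2 * (\<Phi> R - \<Phi> \<epsilon>) - (LINT t|lborel. indicator ?A t * \<psi> t))"
        by (intro has_bochner_integral_diff has_bochner_integral_integrable ip)
      then show ?thesis by (simp add: algebra_simps has_bochner_integral_integral_eq)
    qed
    ultimately show ?thesis by simp
  qed
  have \<Phi>R: "(\<Phi> \<longlongrightarrow> 0) at_top"
  proof (rule tendsto_0_le[of "\<lambda>t. 4 * A / t" _ _ 1])
    show "((\<lambda>t. 4 * A / t) \<longlongrightarrow> 0) at_top" by real_asymp
    show "eventually (\<lambda>t. norm (\<Phi> t) \<le> norm (4 * A / t) * 1) at_top"
      using eventually_gt_at_top[of 0]
    proof eventually_elim
      case (elim t)
      have "\<bar>D2 v x t\<bar> \<le> 4 * A" using bd[of x] bd[of "x+t"] bd[of "x-t"] by (simp add: D2_def)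
      then show ?case using elim by (simp add: \<Phi>_def divide_right_mono)
    qed
  qed
  have \<Phi>0: "(\<Phi> \<longlongrightarrow> 0) (at_right 0)"
  proof -
    \<comment> \<open>As a function of \<open>t\<close>, \<open>D2 v x t\<close> vanishes at 0, so
      \<open>D2 v x t / t\<close> is its difference quotient there.\<close>
    have "((\<lambda>t. D2 v x t) has_real_derivative 0) (at 0)"
      unfolding D2_def
      by (auto intro!: derivative_eq_intros DERIV_chain'[OF _ der, THEN DERIV_cong])
    then have "((\<lambda>t. D2 v x t / t) \<longlongrightarrow> 0) (at 0)"
      by (simp add: has_field_derivative_iff D2_def)
    then have "(\<Phi> \<longlongrightarrow> -0) (at 0)" unfolding \<Phi>_def minus_divide_left[symmetric] by (rule tendsto_minus)
    then show ?thesis using tendsto_mono[OF at_le[of "{0<..}" UNIV]] by simp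
  qed
  have "((\<lambda>z. \<Phi> (snd z) - \<Phi> (fst z) - 1/2 * (case z of (\<epsilon>, R) \<Rightarrow> LINT t|lborel. indicator {t. \<epsilon> < \<bar>t\<bar> \<and> \<bar>t\<bar> < R} t * \<psi> t))
    \<longlongrightarrow> 0 - 0 - 1/2 * (LINT t|lborel. \<psi> t)) (at_right 0 \<times>\<^sub>F at_top)"
    using int by (intro tendsto_diff tendsto_mult tendsto_const tendsto_punctured_integral
        filterlim_compose[OF \<Phi>R filterlim_snd] filterlim_compose[OF \<Phi>0 filterlim_fst]) (auto simp: \<psi>_def)
  moreover have "eventually (\<lambda>z. \<Phi> (snd z) - \<Phi> (fst z) - 1/2 * (case z of (\<epsilon>, R) \<Rightarrow> LINT t|lborel. indicator {t. \<epsilon> < \<bar>t\<bar> \<and> \<bar>t\<bar> < R} t * \<psi> t)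
     = (case z of (\<epsilon>, R) \<Rightarrow> LBINT y:{y. \<epsilon> < \<bar>y - x\<bar> \<and> \<bar>y - x\<bar> < R}. deriv v y / (y - x)))
     (at_right (0::real) \<times>\<^sub>F at_top)"
  proof -
    have "eventually (\<lambda>z. (0 < fst z \<and> fst z < 1) \<and> snd z > 1) (at_right (0::real) \<times>\<^sub>F (at_top :: real filter))"
      by (intro eventually_prodI[of "\<lambda>e. 0 < e \<and> e < 1" _ "\<lambda>R. R > 1", simplified fst_conv] eventually_gt_at_top)
         (auto simp: eventually_at_right_field intro!: exI[of _ 1])
    then show ?thesis
      by eventually_elim (auto simp: main case_prod_beta)
  qed
  ultimately have "((\<lambda>(\<epsilon>, R). LBINT y:{y. \<epsilon> < \<bar>y - x\<bar> \<and> \<bar>y - x\<bar> < R}. deriv v y / (y - x))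
    \<longlongrightarrow> - (1/2) * (LINT t|lborel. \<psi> t)) (at_right 0 \<times>\<^sub>F at_top)"
    by (simp add: tendsto_cong)
  then have "Lim (at_right 0 \<times>\<^sub>F at_top) (\<lambda>(\<epsilon>, R). LBINT y:{y. \<epsilon> < \<bar>y - x\<bar> \<and> \<bar>y - x\<bar> < R}. deriv v y / (y - x))
     = - (1/2) * (LINT t|lborel. \<psi> t)"
    by (intro tendsto_Lim) (auto simp: prod_filter_eq_bot)
  then show ?thesis
    by (simp add: Lam_def hilbert_def LamI_def \<psi>_def)
qed

section \<open>Poisson kernels and product domination\<close>

text \<open>With z = x + i d, \<open>cpoisson d x\<close> is Re (1/z) and \<open>poisson d x\<close>
  is -Im (1/z). The customary 1/pi is left out, so \<open>poisson d\<close> has total mass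
  pi.\<close>

definition poisson :: "real \<Rightarrow> real \<Rightarrow> real" where "poisson d x = d / (x\<^sup>2 + d\<^sup>2)"
definition cpoisson :: "real \<Rightarrow> real \<Rightarrow> real" where "cpoisson d x = x / (x\<^sup>2 + d\<^sup>2)"

lemma sum_squares_pos: "0 < d \<Longrightarrow> 0 < x\<^sup>2 + (d::real)\<^sup>2"
  by (simp add: add_nonneg_pos)

lemma poisson_nonneg: "0 < d \<Longrightarrow> 0 \<le> poisson d x"
  by (simp add: poisson_def)

lemma
  assumes "0 < d"
  shows integrable_poisson: "integrable lborel (poisson d)" and integral_poisson: "(LINT x|lborel. poisson d x) = pi"
proof -
  have der: "((\<lambda>x. arctan (x / d)) has_real_derivative poisson d x) (at x)" for x
    using assms sum_squares_pos[OF assms, of x] unfolding poisson_def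
    by (auto intro!: derivative_eq_intros simp: field_simps power2_eq_square)
  have cont: "isCont (poisson d) x" for x
    unfolding poisson_def using sum_squares_pos[OF assms, of x] by (auto intro!: continuous_intros)
  have top: "((\<lambda>x. arctan (x / d)) \<longlongrightarrow> pi / 2) at_top"
    by (rule filterlim_compose[OF tendsto_arctan_at_top]) (use assms in real_asymp)
  have bot: "((\<lambda>x. arctan (x / d)) \<longlongrightarrow> - (pi / 2)) at_bot"
    by (rule filterlim_compose[OF tendsto_arctan_at_bot]) (use assms in real_asymp)
  have l: "(((\<lambda>x. arctan (x / d)) \<circ> real_of_ereal) \<longlongrightarrow> - (pi / 2)) (at_right (-\<infinity>))"
    "(((\<lambda>x. arctan (x / d)) \<circ> real_of_ereal) \<longlongrightarrow> pi / 2) (at_left \<infinity>)"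
    using bot top by (simp_all add: at_right_MInf at_left_PInf filterlim_filtermap comp_def)
  note ftc = interval_integral_FTC_nonneg[of "-\<infinity>" "\<infinity>", OF _ der cont _ l]
  show "integrable lborel (poisson d)"
    using ftc(1) poisson_nonneg[OF assms] by (simp add: set_integrable_def)
  show "(LINT x|lborel. poisson d x) = pi"
    using ftc(2) poisson_nonneg[OF assms]
    by (simp add: interval_lebesgue_integral_def set_lebesgue_integral_def)
qed

lemma integral_FTC_UNIV:
  fixes F f :: "real \<Rightarrow> 'a::euclidean_space"
  assumes "\<And>x. (F has_vector_derivative f x) (at x)" and "continuous_on UNIV f"
    and "integrable lborel f" and bot: "(F \<longlongrightarrow> A) at_bot" and top: "(F \<longlongrightarrow> B) at_top"
  shows "(LINT x|lborel. f x) = B - A"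
proof -
  have l: "((F \<circ> real_of_ereal) \<longlongrightarrow> A) (at_right (-\<infinity>))" "((F \<circ> real_of_ereal) \<longlongrightarrow> B) (at_left \<infinity>)"
    using bot top by (simp_all add: at_right_MInf at_left_PInf filterlim_filtermap comp_def)
  have "isCont f x" for x using assms(2) by (simp add: continuous_on_eq_continuous_at)
  then show ?thesis
    using interval_integral_FTC_integrable[of "-\<infinity>" "\<infinity>" F f, OF _ assms(1) _ _ l] assms(3)
    by (simp add: interval_lebesgue_integral_def set_lebesgue_integral_def set_integrable_def)
qed

text \<open>The standard majorant at scale 1: bounded near 0, of quadratic decay, with mass
  pi.\<close>

abbreviation weight :: "real \<Rightarrow> real" where "weight \<equiv> poisson 1"

lemma weight_eq: "weight x = 1 / (1 + x\<^sup>2)"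
  by (simp add: poisson_def add.commute)

lemma weight_pos: "0 < weight x"
  by (simp add: weight_eq add_pos_nonneg)

lemma borel_measurable_poisson [measurable]: "poisson d \<in> borel_measurable borel"
  unfolding poisson_def by measurable

lemma borel_measurable_cpoisson [measurable]: "cpoisson d \<in> borel_measurable borel"
  unfolding cpoisson_def by measurable

lemma integrable_weight: "integrable lborel weight"
  by (simp add: integrable_poisson)

text \<open>For fixed \<open>x\<close> the inner integral runs over a translate or reflection of
  \<open>b\<close>, so its L1 norm is independent of \<open>x\<close> and Tonelli factorises the
  double integral.\<close>

lemma integrable_product_shear:
  fixes a b :: "real \<Rightarrow> real"
  assumes a: "integrable lborel a" and b: "integrable lborel b" and e: "e \<in> {1, -1}"
  shows "integrable (lborel \<Otimes>\<^sub>M lborel) (\<lambda>(x, t). a x * b (x + e * t))"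
proof (rule lborel_pair.Fubini_integrable)
  have [measurable]: "a \<in> borel_measurable borel" "b \<in> borel_measurable borel"
    using borel_measurable_integrable[OF a] borel_measurable_integrable[OF b] by simp_all
  show "(\<lambda>(x, t). a x * b (x + e * t)) \<in> borel_measurable (lborel \<Otimes>\<^sub>M lborel)"
    by measurable
  have bt: "integrable lborel (\<lambda>t. b (x + e * t))" for x
    using e b by (intro lborel_integrable_real_affine) auto
  then show "AE x in lborel. integrable lborel (\<lambda>t. case (x, t) of (x, t) \<Rightarrow> a x * b (x + e * t))"
    by auto
  have "(LINT t|lborel. \<bar>b (x + e * t)\<bar>) = (LINT t|lborel. \<bar>b t\<bar>)" for x
    using lborel_integral_real_affine[of e "\<lambda>t. \<bar>b t\<bar>" x] e by auto
  then have "(\<lambda>x. LINT t|lborel. norm (case (x, t) of (x, t) \<Rightarrow> a x * b (x + e * t)))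
      = (\<lambda>x. \<bar>a x\<bar> * (LINT t|lborel. \<bar>b t\<bar>))"
    by (simp add: abs_mult)
  then show "integrable lborel (\<lambda>x. LINT t|lborel. norm (case (x, t) of (x, t) \<Rightarrow> a x * b (x + e * t)))"
    using a by simp
qed

lemma integrable_product:
  fixes a b :: "real \<Rightarrow> real"
  assumes a: "integrable lborel a" and b: "integrable lborel b"
  shows "integrable (lborel \<Otimes>\<^sub>M lborel) (\<lambda>(x, t). a x * b t)"
proof (rule lborel_pair.Fubini_integrable)
  have [measurable]: "a \<in> borel_measurable borel" "b \<in> borel_measurable borel"
    using borel_measurable_integrable[OF a] borel_measurable_integrable[OF b] by simp_all
  show "(\<lambda>(x, t). a x * b t) \<in> borel_measurable (lborel \<Otimes>\<^sub>M lborel)"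
    by measurable
qed (use a b in \<open>auto simp: abs_mult\<close>)

text \<open>Here \<open>a\<close> depends on \<open>t\<close>, so the inner integral has to run over
  \<open>x\<close>; Tonelli is applied with the variables exchanged, and they are swapped back at
  the end.\<close>

lemma integrable_product_shear_t:
  fixes a b :: "real \<Rightarrow> real"
  assumes a: "integrable lborel a" and b: "integrable lborel b" and e: "e \<in> {1, -1}"
  shows "integrable (lborel \<Otimes>\<^sub>M lborel) (\<lambda>(x, t). a t * b (x + e * t))"
proof -
  have "integrable (lborel \<Otimes>\<^sub>M lborel) (\<lambda>(t, x). a t * b (e * t + 1 * x))"
  proof (rule lborel_pair.Fubini_integrable)
    have [measurable]: "a \<in> borel_measurable borel" "b \<in> borel_measurable borel"
      using borel_measurable_integrable[OF a] borel_measurable_integrable[OF b] by simp_all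
    show "(\<lambda>(t, x). a t * b (e * t + 1 * x)) \<in> borel_measurable (lborel \<Otimes>\<^sub>M lborel)"
      by measurable
    have bt: "integrable lborel (\<lambda>x. b (e * t + 1 * x))" for t
      using b by (intro lborel_integrable_real_affine) auto
    then show "AE t in lborel. integrable lborel (\<lambda>x. case (t, x) of (t, x) \<Rightarrow> a t * b (e * t + 1 * x))"
      by auto
    have "(LINT x|lborel. \<bar>b (e * t + x)\<bar>) = (LINT t|lborel. \<bar>b t\<bar>)" for t
      using lborel_integral_real_affine[of 1 "\<lambda>t. \<bar>b t\<bar>" "e * t"] by auto
    then have "(\<lambda>t. LINT x|lborel. norm (case (t, x) of (t, x) \<Rightarrow> a t * b (e * t + 1 * x)))
        = (\<lambda>t. \<bar>a t\<bar> * (LINT t|lborel. \<bar>b t\<bar>))"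
      by (simp add: abs_mult)
    then show "integrable lborel (\<lambda>t. LINT x|lborel. norm (case (t, x) of (t, x) \<Rightarrow> a t * b (e * t + 1 * x)))"
      using a by simp
  qed
  from lborel_pair.integrable_product_swap[OF this] show ?thesis
    by (simp add: case_prod_beta add.commute)
qed

text \<open>The t-derivative of the second difference at z is
  \<open>v1 (x - z) - v1 (x + z)\<close>, of size at most 2 B z; one mean value step gives 2 B t^2.
  Evenness in \<open>t\<close> covers the negative side.\<close>

lemma D2_bound_Lipschitz:
  assumes der: "\<And>x. (v has_real_derivative v1 x) (at x)"
    and lip: "\<And>x y. \<bar>v1 x - v1 y\<bar> \<le> B * \<bar>x - y\<bar>"
  shows "\<bar>D2 v x t\<bar> \<le> 2 * B * t\<^sup>2"
proof -
  have pos: "\<bar>D2 v x t\<bar> \<le> 2 * B * t\<^sup>2" if "t > 0" for t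
  proof -
    have "\<exists>z>0. z < t \<and> D2 v x t - D2 v x 0 = (t - 0) * (v1 (x - z) - v1 (x + z))"
      unfolding D2_def
      by (rule MVT2[OF that])
         (auto intro!: derivative_eq_intros DERIV_chain'[OF _ der, THEN DERIV_cong])
    then obtain z where z: "0 < z" "z < t" "D2 v x t = t * (v1 (x - z) - v1 (x + z))"
      by (auto simp: D2_def)
    have "\<bar>v1 (x - z) - v1 (x + z)\<bar> \<le> B * (2 * z)"
      using lip[of "x - z" "x + z"] z by simp
    also have "\<dots> \<le> B * (2 * t)"
    proof -
      have "0 \<le> B" using lip[of 1 0] by simp
      then show ?thesis using z by (intro mult_left_mono) auto
    qed
    finally show ?thesis using z that by (simp add: abs_mult power2_eq_square)
  qed
  consider "t > 0" | "t = 0" | "-t > 0" by linarith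
  then show ?thesis
    using pos[of t] pos[of "-t"] by cases (auto simp: D2_def algebra_simps)
qed

lemma Lipschitz_if_deriv_bounded:
  assumes "\<And>x. (v has_real_derivative v1 x) (at x)" and "\<And>x. \<bar>v1 x\<bar> \<le> B"
  shows "\<bar>v x - v y\<bar> \<le> B * \<bar>x - y\<bar>"
  using field_differentiable_bound[of UNIV v v1 B x y] assms by (simp add: has_field_derivative_at_within)

text \<open>The two bounds combine through min(B, A/t^2) \<le> (A + B)/(1 + t^2).\<close>

lemma D2_weight_bound:
  assumes "\<bar>D2 v x t\<bar> \<le> B * t\<^sup>2" "\<bar>D2 v x t\<bar> \<le> A" "0 \<le> B"
  shows "\<bar>D2 v x t / t\<^sup>2\<bar> \<le> (A + B) * weight t"
proof (cases "t = 0")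
  case True
  then show ?thesis using assms by (simp add: D2_def weight_eq)
next
  case False
  have "\<bar>D2 v x t\<bar> * (1 + t\<^sup>2) \<le> (A + B) * t\<^sup>2"
    using mult_right_mono[OF assms(2), of "t\<^sup>2"] assms(1) by (simp add: algebra_simps)
  then show ?thesis
    using False by (simp add: weight_eq divide_le_eq pos_le_divide_eq add_pos_nonneg abs_mult field_simps)
qed

lemma D2_bound_trivial: "(\<And>x. \<bar>v x\<bar> \<le> A) \<Longrightarrow> \<bar>D2 v x t\<bar> \<le> 4 * A"
  unfolding D2_def by (smt (verit, ccfv_threshold))

lemma borel_measurable_D2 [measurable]:
  assumes [measurable]: "v \<in> borel_measurable borel"
  shows "(\<lambda>t. D2 v x t) \<in> borel_measurable borel"
  unfolding D2_def by measurable

lemma integrable_D2_if_bound: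
  assumes "v \<in> borel_measurable borel" "integrable lborel W" "\<And>t. \<bar>D2 v x t / t\<^sup>2\<bar> \<le> W t"
  shows "integrable lborel (\<lambda>t. D2 v x t / t\<^sup>2)"
proof (rule Bochner_Integration.integrable_bound[OF assms(2)])
  show "AE t in lborel. norm (D2 v x t / t\<^sup>2) \<le> norm (W t)"
    using assms(3) order_trans[OF _ abs_ge_self] by (intro AE_I2) auto
qed (use assms(1) in measurable)

lemma LamI_bound:
  assumes "v \<in> borel_measurable borel" "\<And>t. \<bar>D2 v x t / t\<^sup>2\<bar> \<le> B * weight t"
  shows "\<bar>LamI v x\<bar> \<le> B / 2"
proof -
  have "\<bar>LINT t|lborel. D2 v x t / t\<^sup>2\<bar> \<le> (LINT t|lborel. \<bar>D2 v x t / t\<^sup>2\<bar>)"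
    by (rule integral_abs_bound)
  also have "\<dots> \<le> (LINT t|lborel. B * weight t)"
    using assms by (intro integral_mono integrable_abs integrable_D2_if_bound[where W="\<lambda>t. B * weight t"])
      (auto simp: integrable_weight)
  also have "\<dots> = B * pi" using integral_poisson[of 1] by simp
  finally show ?thesis
    by (simp add: LamI_def abs_mult field_simps)
qed

lemma continuous_on_LamI:
  assumes v: "continuous_on UNIV v" and W: "integrable lborel W" "\<And>x t. \<bar>D2 v x t / t\<^sup>2\<bar> \<le> W t"
  shows "continuous_on UNIV (LamI v)"
proof (rule continuous_at_imp_continuous_on, rule ballI)
  fix x
  have [measurable]: "v \<in> borel_measurable borel" using v by (rule borel_measurable_continuous_onI)
  show "isCont (LamI v) x"
    unfolding continuous_at_sequentially
  proof (intro allI impI)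
    fix S :: "nat \<Rightarrow> real" assume S: "S \<longlonglongrightarrow> x"
    have vt: "(\<lambda>n. v (S n + c)) \<longlonglongrightarrow> v (x + c)" for c
      using v S by (intro isCont_tendsto_compose[of _ v] tendsto_intros) (auto simp: continuous_on_eq_continuous_at)
    have "(\<lambda>n. LINT t|lborel. D2 v (S n) t / t\<^sup>2) \<longlonglongrightarrow> (LINT t|lborel. D2 v x t / t\<^sup>2)"
    proof (rule integral_dominated_convergence[OF _ _ W(1)])
      show "AE t in lborel. (\<lambda>n. D2 v (S n) t / t\<^sup>2) \<longlonglongrightarrow> D2 v x t / t\<^sup>2"
      proof (rule AE_I2)
        fix t :: real
        show "(\<lambda>n. D2 v (S n) t / t\<^sup>2) \<longlonglongrightarrow> D2 v x t / t\<^sup>2"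
          unfolding D2_def divide_inverse using vt[of 0] vt[of t] vt[of "-t"] by (auto intro!: tendsto_intros)
      qed
    qed (use W(2) in \<open>auto intro!: AE_I2\<close>)
    then show "(LamI v \<circ> S) \<longlonglongrightarrow> LamI v x"
      unfolding LamI_def comp_def by (intro tendsto_intros)
  qed
qed

text \<open>Differentiation under the integral sign: by the mean value theorem in \<open>x\<close>,
  the majorant \<open>W\<close> of the differentiated integrand also dominates the difference
  quotients.\<close>

lemma DERIV_LamI:
  assumes der: "\<And>x. (v has_real_derivative v1 x) (at x)" and v1: "v1 \<in> borel_measurable borel"
    and W: "integrable lborel W" "\<And>x t. \<bar>D2 v1 x t / t\<^sup>2\<bar> \<le> W t"
    and int: "\<And>x. integrable lborel (\<lambda>t. D2 v x t / t\<^sup>2)"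
  shows "(LamI v has_real_derivative LamI v1 x) (at x)"
proof -
  have "continuous_on UNIV v"
    using der by (meson DERIV_continuous continuous_at_imp_continuous_on)
  then have [measurable]: "v \<in> borel_measurable borel" by (rule borel_measurable_continuous_onI)
  note [measurable] = v1
  have derD: "((\<lambda>y. D2 v y t) has_real_derivative D2 v1 y t) (at y)" for t y
    unfolding D2_def by (auto intro!: derivative_eq_intros DERIV_chain'[OF _ der, THEN DERIV_cong])
  have "((\<lambda>h. (LamI v (x + h) - LamI v x) / h) \<longlongrightarrow> LamI v1 x) (at 0)"
    unfolding tendsto_at_iff_sequentially
  proof (intro allI impI)
    fix S :: "nat \<Rightarrow> real" assume S: "\<forall>i. S i \<in> UNIV - {0}" "S \<longlonglongrightarrow> 0"
    have eq: "(D2 v (x + S n) t - D2 v x t) / S n / t\<^sup>2 = (D2 v (x + S n) t / t\<^sup>2 - D2 v x t / t\<^sup>2) / S n" for n t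
      by (simp add: diff_divide_distrib divide_divide_eq_left mult.commute[of "S n" "t\<^sup>2"])
    have "(\<lambda>n. LINT t|lborel. (D2 v (x + S n) t - D2 v x t) / S n / t\<^sup>2) \<longlonglongrightarrow> (LINT t|lborel. D2 v1 x t / t\<^sup>2)"
    proof (rule integral_dominated_convergence[OF _ _ W(1)])
      show "AE t in lborel. (\<lambda>n. (D2 v (x + S n) t - D2 v x t) / S n / t\<^sup>2) \<longlonglongrightarrow> D2 v1 x t / t\<^sup>2"
      proof (rule AE_I2)
        fix t :: real
        have "((\<lambda>h. (D2 v (x + h) t - D2 v x t) / h) \<longlongrightarrow> D2 v1 x t) (at 0)"
          using derD[of t x] by (simp add: DERIV_def)
        then have "(\<lambda>n. (D2 v (x + S n) t - D2 v x t) / S n) \<longlonglongrightarrow> D2 v1 x t"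
          using S unfolding tendsto_at_iff_sequentially by (auto simp: comp_def)
        then show "(\<lambda>n. (D2 v (x + S n) t - D2 v x t) / S n / t\<^sup>2) \<longlonglongrightarrow> D2 v1 x t / t\<^sup>2"
          unfolding divide_inverse[of _ "t\<^sup>2"] by (intro tendsto_intros)
      qed
      show "AE t in lborel. norm ((D2 v (x + S n) t - D2 v x t) / S n / t\<^sup>2) \<le> W t" for n
      proof (rule AE_I2)
        fix t :: real
        have *: "\<bar>D2 v (x + S n) t / t\<^sup>2 - D2 v x t / t\<^sup>2\<bar> \<le> W t * \<bar>(x + S n) - x\<bar>"
          by (rule Lipschitz_if_deriv_bounded[where v="\<lambda>y. D2 v y t / t\<^sup>2" and ?v1.0="\<lambda>y. D2 v1 y t / t\<^sup>2"])
             (use W(2) in \<open>auto intro!: DERIV_cdivide derD\<close>)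
        then show "norm ((D2 v (x + S n) t - D2 v x t) / S n / t\<^sup>2) \<le> W t"
          unfolding eq using S(1) by (simp add: abs_divide pos_divide_le_eq)
      qed
    qed auto
    moreover have "(LINT t|lborel. (D2 v (x + S n) t - D2 v x t) / S n / t\<^sup>2)
       = ((LINT t|lborel. D2 v (x + S n) t / t\<^sup>2) - (LINT t|lborel. D2 v x t / t\<^sup>2)) / S n" for n
      unfolding eq using int by (simp add: Bochner_Integration.integral_diff)
    ultimately have "(\<lambda>n. 1 / (2 * pi) * (((LINT t|lborel. D2 v (x + S n) t / t\<^sup>2) - (LINT t|lborel. D2 v x t / t\<^sup>2)) / S n))
       \<longlonglongrightarrow> LamI v1 x"
      unfolding LamI_def by (intro tendsto_intros) simp
    then show "((\<lambda>h. (LamI v (x + h) - LamI v x) / h) \<circ> S) \<longlonglongrightarrow> LamI v1 x"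
      by (simp add: LamI_def comp_def algebra_simps diff_divide_distrib)
  qed
  then show ?thesis by (simp add: DERIV_def)
qed

section \<open>Regularity of the operator and of the difference quotient\<close>

text \<open>One constant bounds the function and its three derivatives. The bound on
  \<open>f3\<close> enters as a Lipschitz constant for \<open>f2\<close>.\<close>

locale C3b =
  fixes f f1 f2 f3 :: "real \<Rightarrow> real" and M :: real
  assumes der0: "(f has_real_derivative f1 x) (at x)"
    and der1: "(f1 has_real_derivative f2 x) (at x)"
    and der2: "(f2 has_real_derivative f3 x) (at x)"
    and bd0: "\<bar>f x\<bar> \<le> M" and bd1: "\<bar>f1 x\<bar> \<le> M" and bd2: "\<bar>f2 x\<bar> \<le> M" and bd3: "\<bar>f3 x\<bar> \<le> M"
begin

lemma M_nonneg: "0 \<le> M"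
  using bd0[of 0] by simp

lemma cont0: "continuous_on S f" and cont1: "continuous_on S f1" and cont2: "continuous_on S f2"
  using der0 der1 der2 by (meson DERIV_continuous continuous_at_imp_continuous_on)+

lemma meas [measurable]:
  "f \<in> borel_measurable borel" "f1 \<in> borel_measurable borel" "f2 \<in> borel_measurable borel"
  using cont0 cont1 cont2 by (auto intro: borel_measurable_continuous_onI)

lemma lip0: "\<bar>f x - f y\<bar> \<le> M * \<bar>x - y\<bar>" and lip1: "\<bar>f1 x - f1 y\<bar> \<le> M * \<bar>x - y\<bar>"
  and lip2: "\<bar>f2 x - f2 y\<bar> \<le> M * \<bar>x - y\<bar>"
  by (rule Lipschitz_if_deriv_bounded[OF der0 bd1] Lipschitz_if_deriv_bounded[OF der1 bd2]
      Lipschitz_if_deriv_bounded[OF der2 bd3])+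

lemma D2f: "\<bar>D2 f x t\<bar> \<le> 2 * M * t\<^sup>2" and D2f1: "\<bar>D2 f1 x t\<bar> \<le> 2 * M * t\<^sup>2"
  by (rule D2_bound_Lipschitz[OF der0 lip1] D2_bound_Lipschitz[OF der1 lip2])+

text \<open>6 = 4 + 2: boundedness gives 4 M for large \<open>t\<close>, the Lipschitz derivative 2
  M for small \<open>t\<close>.\<close>

lemma D2f_weight: "\<bar>D2 f x t / t\<^sup>2\<bar> \<le> 6 * M * weight t" and D2f1_weight: "\<bar>D2 f1 x t / t\<^sup>2\<bar> \<le> 6 * M * weight t"
  using D2_weight_bound[OF D2f D2_bound_trivial[of f, OF bd0], of x t] D2_weight_bound[OF D2f1 D2_bound_trivial[of f1, OF bd1], of x t]
    M_nonneg by (simp_all add: mult_2 algebra_simps)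

lemma int_D2f: "integrable lborel (\<lambda>t. D2 f x t / t\<^sup>2)"
  by (rule integrable_D2_if_bound[OF meas(1) _ D2f_weight]) (simp add: integrable_weight)

abbreviation "L \<equiv> LamI f"
abbreviation "L1 \<equiv> LamI f1"

lemma Lam_f: "Lam f = L"
  using Lam_eq_LamI[OF der0 cont1 bd0 int_D2f] by auto

lemma derL: "(L has_real_derivative L1 x) (at x)"
  by (rule DERIV_LamI[OF der0 meas(2) _ D2f1_weight int_D2f]) (simp add: integrable_weight)

lemma contL1: "continuous_on UNIV L1"
  by (rule continuous_on_LamI[OF cont1 _ D2f1_weight]) (simp add: integrable_weight)

lemma contL: "continuous_on S L"
  using derL by (meson DERIV_continuous continuous_at_imp_continuous_on)

lemma measL [measurable]: "L \<in> borel_measurable borel"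
  using contL by (auto intro: borel_measurable_continuous_onI)

lemma bdL: "\<bar>L x\<bar> \<le> 3 * M" and bdL1: "\<bar>L1 x\<bar> \<le> 3 * M"
  using LamI_bound[OF meas(1) D2f_weight] LamI_bound[OF meas(2) D2f1_weight] by auto

lemma lipL: "\<bar>L x - L y\<bar> \<le> 3 * M * \<bar>x - y\<bar>"
  by (rule Lipschitz_if_deriv_bounded[OF derL bdL1])

section \<open>Smoothness and decay of the difference quotient\<close>

abbreviation "g \<equiv> diffquot f"

lemma x_g: "x * g x = f x - f 0"
  by (simp add: diffquot_def)

definition "g1 x = integral {0..1} (\<lambda>s. s * f2 (s * x))"

text \<open>Hadamard's representation: \<open>g\<close> is an average of the derivative over the
  segment from 0 to \<open>x\<close>. The singularity at 0 disappears, and \<open>g\<close> inherits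
  its regularity from \<open>f1\<close> by differentiating under the integral.\<close>

lemma g_integral: "g x = integral {0..1} (\<lambda>s. f1 (s * x))"
proof (cases "x = 0")
  case True
  then show ?thesis using der0[of 0, THEN DERIV_imp_deriv] by (simp add: diffquot_def)
next
  case False
  have "((\<lambda>s. f1 (s * x)) has_integral f (1 * x) / x - f (0 * x) / x) {0..1}"
    using False
    by (intro fundamental_theorem_of_calculus)
       (auto intro!: has_vector_derivative_at_within derivative_eq_intros DERIV_chain'[OF _ der0, THEN DERIV_cong]
         simp flip: has_real_derivative_iff_has_vector_derivative)
  then show ?thesis using False by (simp add: diffquot_def integral_unique diff_divide_distrib)
qed

lemma derg: "(g has_real_derivative g1 x) (at x)"
proof -
  have "((\<lambda>x. integral (cbox 0 1) (\<lambda>s. f1 (s * x))) has_real_derivative integral (cbox 0 1) (\<lambda>s. s * f2 (s * x))) (at x within UNIV)"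
  proof (rule leibniz_rule_field_derivative)
    show "((\<lambda>x. f1 (s * x)) has_real_derivative s * f2 (s * x)) (at x within UNIV)" for x s
      by (auto intro!: derivative_eq_intros DERIV_chain'[OF _ der1, THEN DERIV_cong])
    show "(\<lambda>s. f1 (s * x)) integrable_on cbox 0 1" for x
      by (intro integrable_continuous continuous_on_compose2[OF cont1[of UNIV]] continuous_intros) auto
    show "continuous_on (UNIV \<times> cbox 0 1) (\<lambda>(x, s). s * f2 (s * x))"
      unfolding case_prod_beta
      by (intro continuous_intros continuous_on_compose2[OF cont2[of UNIV]]) auto
  qed auto
  then show ?thesis
    unfolding g1_def g_integral[abs_def] by simp
qed

lemma contg1: "continuous_on UNIV g1"
proof -
  have "continuous_on UNIV (\<lambda>x. integral (cbox 0 1) (\<lambda>s. s * f2 (s * x)))"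
    by (rule integral_continuous_on_param)
       (auto simp: case_prod_beta intro!: continuous_intros continuous_on_compose2[OF cont2[of UNIV]])
  then show ?thesis by (simp add: g1_def[abs_def])
qed

lemma contg: "continuous_on S g"
  using derg by (meson DERIV_continuous continuous_at_imp_continuous_on)

lemma measg [measurable]: "g \<in> borel_measurable borel"
  using contg by (auto intro: borel_measurable_continuous_onI)

lemma integrable_g1: "(\<lambda>s. s * f2 (s * x)) integrable_on {0..1}"
  by (intro integrable_continuous_interval continuous_intros continuous_on_compose2[OF cont2[of UNIV]]) auto

lemma integral_unit_bound:
  fixes u :: "real \<Rightarrow> real"
  assumes "u integrable_on {0..1}" "\<And>s. 0 \<le> s \<Longrightarrow> s \<le> 1 \<Longrightarrow> \<bar>u s\<bar> \<le> B"
  shows "\<bar>integral {0..1} u\<bar> \<le> B"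
  using integral_norm_bound_integral[OF assms(1), of "\<lambda>_. B"] assms(2) by auto

lemma bdg1: "\<bar>g1 x\<bar> \<le> M"
  unfolding g1_def
proof (rule integral_unit_bound[OF integrable_g1])
  fix s :: real assume "0 \<le> s" "s \<le> 1"
  then show "\<bar>s * f2 (s * x)\<bar> \<le> M"
    using mult_mono[of s 1 "\<bar>f2 (s * x)\<bar>" M] bd2[of "s * x"] by (simp add: abs_mult)
qed

lemma lipg1: "\<bar>g1 x - g1 y\<bar> \<le> M * \<bar>x - y\<bar>"
proof -
  have "g1 x - g1 y = integral {0..1} (\<lambda>s. s * f2 (s * x) - s * f2 (s * y))"
    unfolding g1_def by (simp add: integral_diff integrable_g1)
  also have "\<bar>\<dots>\<bar> \<le> M * \<bar>x - y\<bar>"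
  proof (rule integral_unit_bound)
    show "(\<lambda>s. s * f2 (s * x) - s * f2 (s * y)) integrable_on {0..1}"
      by (intro integrable_diff integrable_g1)
    fix s :: real assume s: "0 \<le> s" "s \<le> 1"
    have "\<bar>s * f2 (s * x) - s * f2 (s * y)\<bar> = s * \<bar>f2 (s * x) - f2 (s * y)\<bar>"
      using s by (simp add: abs_mult flip: right_diff_distrib)
    also have "\<dots> \<le> 1 * (M * (1 * \<bar>x - y\<bar>))"
    proof (intro mult_mono)
      have "\<bar>f2 (s * x) - f2 (s * y)\<bar> \<le> M * (s * \<bar>x - y\<bar>)"
        using lip2[of "s * x" "s * y"] s by (simp add: abs_mult flip: right_diff_distrib)
      also have "\<dots> \<le> M * (1 * \<bar>x - y\<bar>)"
        using s M_nonneg by (intro mult_left_mono mult_right_mono) auto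
      finally show "\<bar>f2 (s * x) - f2 (s * y)\<bar> \<le> M * (1 * \<bar>x - y\<bar>)" .
    qed (use s in auto)
    finally show "\<bar>s * f2 (s * x) - s * f2 (s * y)\<bar> \<le> M * \<bar>x - y\<bar>" by simp
  qed
  finally show ?thesis .
qed

lemma lipg: "\<bar>g x - g y\<bar> \<le> M * \<bar>x - y\<bar>"
  by (rule Lipschitz_if_deriv_bounded[OF derg bdg1])

lemma bdg: "\<bar>g x\<bar> \<le> M"
proof (cases "x = 0")
  case True
  then show ?thesis using der0[of 0, THEN DERIV_imp_deriv] bd1[of 0] by (simp add: diffquot_def)
next
  case False
  then show ?thesis using lip0[of x 0] by (simp add: diffquot_def divide_le_eq)
qed

lemma D2g: "\<bar>D2 g x t\<bar> \<le> 2 * M * t\<^sup>2"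
  by (rule D2_bound_Lipschitz[OF derg lipg1])

lemma D2g_weight: "\<bar>D2 g x t / t\<^sup>2\<bar> \<le> 6 * M * weight t"
  using D2_weight_bound[OF D2g D2_bound_trivial[of g, OF bdg], of x t] M_nonneg by (simp add: algebra_simps)

lemma int_D2g: "integrable lborel (\<lambda>t. D2 g x t / t\<^sup>2)"
  by (rule integrable_D2_if_bound[OF measg _ D2g_weight]) (simp add: integrable_weight)

lemma Lam_g: "Lam g = LamI g"
  using Lam_eq_LamI[OF derg contg1 bdg int_D2g] by auto

text \<open>\<open>g\<close> is at most M everywhere and at most 2 M / |x| for large
  \<open>x\<close>, whence 5 = 1 + 4. In general only the square of \<open>g\<close> is integrable,
  so later estimates pair two factors of this decay.\<close>

lemma g_sq_bound: "(g x)\<^sup>2 \<le> 5 * M\<^sup>2 * weight x"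
proof -
  have "(g x)\<^sup>2 \<le> M\<^sup>2"
    using bdg[of x] abs_le_square_iff[of "g x" M] M_nonneg by simp
  moreover have "(x * g x)\<^sup>2 \<le> (2 * M)\<^sup>2"
    unfolding x_g using bd0[of x] bd0[of 0] M_nonneg by (intro abs_le_square_iff[THEN iffD1]) auto
  ultimately have "(g x)\<^sup>2 * (1 + x\<^sup>2) \<le> 5 * M\<^sup>2"
    by (simp add: algebra_simps power_mult_distrib)
  then show ?thesis by (simp add: weight_eq pos_le_divide_eq add_pos_nonneg)
qed

text \<open>The commutator of multiplication by \<open>x\<close> with the second difference. Divided
  by t^2 and integrated, it becomes x \<Lambda>g = \<Lambda>f + Hg.\<close>

lemma x_D2g: "x * D2 g x t = D2 f x t + t * (g (x + t) - g (x - t))"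
  using x_g[of x] x_g[of "x + t"] x_g[of "x - t"] unfolding D2_def by (simp add: algebra_simps)

text \<open>20 = 4 + 16: the Lipschitz bound on \<open>g1\<close> gives the 4, and the commutator,
  with the Lipschitz bound on \<open>g\<close>, gives the 16 after multiplication by x^2. The point
  is decay in \<open>x\<close> that is uniform in \<open>t\<close>.\<close>

lemma D2g_sq_bound: "(D2 g x t / t\<^sup>2)\<^sup>2 \<le> 20 * M\<^sup>2 * weight x"
proof (cases "t = 0")
  case True
  then show ?thesis using weight_pos[of x] M_nonneg by simp
next
  case False
  have "(D2 g x t)\<^sup>2 \<le> (2 * M * t\<^sup>2)\<^sup>2"
    using D2g[of x t] M_nonneg by (intro abs_le_square_iff[THEN iffD1]) auto
  moreover have "(x * D2 g x t)\<^sup>2 \<le> (4 * M * t\<^sup>2)\<^sup>2"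
  proof (intro abs_le_square_iff[THEN iffD1])
    have "\<bar>t * (g (x + t) - g (x - t))\<bar> \<le> \<bar>t\<bar> * (M * (2 * \<bar>t\<bar>))"
      unfolding abs_mult using lipg[of "x + t" "x - t"] by (intro mult_left_mono) auto
    then have "\<bar>t * (g (x + t) - g (x - t))\<bar> \<le> 2 * M * t\<^sup>2"
      by (simp add: power2_eq_square algebra_simps)
    then show "\<bar>x * D2 g x t\<bar> \<le> \<bar>4 * M * t\<^sup>2\<bar>"
      unfolding x_D2g using D2f[of x t] M_nonneg
        abs_triangle_ineq[of "D2 f x t" "t * (g (x + t) - g (x - t))"] by (simp add: abs_mult)
  qed
  ultimately have "(D2 g x t)\<^sup>2 * (1 + x\<^sup>2) \<le> 20 * M\<^sup>2 * (t\<^sup>2)\<^sup>2"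
    by (simp add: algebra_simps power_mult_distrib)
  then show ?thesis using False
    by (simp add: weight_eq power_divide pos_le_divide_eq add_pos_nonneg divide_le_eq)
qed

end

section \<open>Positivity and the regularised Cotlar identity\<close>

lemma weight_ge_half: "\<bar>t\<bar> \<le> 1 \<Longrightarrow> 1 \<le> 2 * weight t"
  using abs_square_le_1[of t] by (simp add: weight_eq pos_le_divide_eq add_pos_nonneg)

lemma inverse_square_le_weight: "1 \<le> \<bar>t\<bar> \<Longrightarrow> 1 / t\<^sup>2 \<le> 2 * weight t"
  using abs_square_le_1[of t] abs_le_square_iff[of 1 t]
  by (simp add: weight_eq divide_simps add_pos_nonneg)

lemma abs_mult_le_sum_squares: "\<bar>a * b\<bar> \<le> (a\<^sup>2 + b\<^sup>2) / 2" for a b :: real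
  using sum_squares_bound[of "\<bar>a\<bar>" "\<bar>b\<bar>"] by (simp add: abs_mult)

lemma integrable_mult_bounded:
  fixes u v :: "real \<Rightarrow> real"
  assumes u: "integrable lborel u" and [measurable]: "v \<in> borel_measurable borel" and bd: "\<And>x. \<bar>v x\<bar> \<le> B"
  shows "integrable lborel (\<lambda>x. u x * v x)"
proof (rule Bochner_Integration.integrable_bound)
  have [measurable]: "u \<in> borel_measurable borel" using borel_measurable_integrable[OF u] by simp
  show "(\<lambda>x. u x * v x) \<in> borel_measurable lborel" by measurable
  show "integrable lborel (\<lambda>x. u x * B)" using u by simp
  have "0 \<le> B" using bd[of 0] by simp
  then show "AE x in lborel. norm (u x * v x) \<le> norm (u x * B)"
    using bd by (intro AE_I2) (auto simp: abs_mult intro!: mult_left_mono)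
qed

lemma integral_even_part:
  fixes u :: "real \<Rightarrow> real"
  assumes "integrable lborel u"
  shows "2 * (LINT x|lborel. u x) = (LINT x|lborel. u x + u (- x))"
  using assms integral_lborel_reflect[of u] integrable_lborel_reflect[of u] by simp

lemma cpoisson_le_inverse: "\<bar>cpoisson d x\<bar> \<le> 1 / \<bar>x\<bar>"
proof (cases "x = 0")
  case False
  then have "x\<^sup>2 + d\<^sup>2 > 0" by (simp add: add_pos_nonneg)
  then show ?thesis using False
    by (simp add: cpoisson_def abs_divide divide_le_eq pos_le_divide_eq flip: power2_eq_square)
qed (simp add: cpoisson_def)

lemma cpoisson_minus: "cpoisson d (- x) = - cpoisson d x"
  by (simp add: cpoisson_def)

lemma tendsto_cpoisson: "d \<longlonglongrightarrow> 0 \<Longrightarrow> (\<lambda>n. cpoisson (d n) x) \<longlonglongrightarrow> 1 / x"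
proof (cases "x = 0")
  case False
  assume "d \<longlonglongrightarrow> 0"
  then have "(\<lambda>n. cpoisson (d n) x) \<longlonglongrightarrow> x / (x\<^sup>2 + 0\<^sup>2)"
    unfolding cpoisson_def using False by (intro tendsto_intros) auto
  then show ?thesis using False by (simp add: power2_eq_square)
\<comment> \<open>At x = 0 both sides are 0, by the convention 1 / 0 = 0.\<close>
qed (simp add: cpoisson_def)

lemma integral_eq_LamI: "(LINT t|lborel. D2 v x t / t\<^sup>2) = 2 * pi * LamI v x"
  by (simp add: LamI_def)

section \<open>Integrability and sign of the seminorm integrand\<close>

context C3b begin

lemma M2_weight_nonneg: "0 \<le> M\<^sup>2 * weight x"
  by (simp add: less_imp_le[OF weight_pos])

text \<open>Bounding the second difference by \<open>weight t\<close> alone would leave |g x|, which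
  is not integrable in general. Decay in \<open>x\<close> is drawn from both factors through 2ab
  \<le> a^2 + b^2: for |t| \<le> 1 from \<open>D2g_sq_bound\<close>, otherwise from the three values
  of \<open>g\<close> in the second difference. The second case dictates 15 = 3 * 5, and passing to
  \<open>2 * weight t\<close> doubles it.\<close>

lemma LamI_g_kernel_bound:
  "\<bar>g x * (D2 g x t / t\<^sup>2)\<bar> \<le> 30 * M\<^sup>2 * (weight x * weight t + weight t * weight (x + t) + weight t * weight (x - t))"
proof -
  \<comment> \<open>\<open>r\<close> is 1 in the case |t| \<le> 1 and 1/t^2 in the other.\<close>
  have mono: "c \<le> 30 * M\<^sup>2 * (weight x * weight t + weight t * weight (x + t) + weight t * weight (x - t))"
    if "c \<le> 15 * M\<^sup>2 * (r * weight x + r * weight (x + t) + r * weight (x - t))" "r \<le> 2 * weight t" for c r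
  proof -
    have "r * (weight x + weight (x + t) + weight (x - t)) \<le> 2 * weight t * (weight x + weight (x + t) + weight (x - t))"
      using weight_pos[of x] weight_pos[of "x+t"] weight_pos[of "x-t"] by (intro mult_right_mono that) auto
    from mult_left_mono[OF this, of "15 * M\<^sup>2"] show ?thesis
      using that(1) by (simp add: algebra_simps)
  qed
  show ?thesis
  proof (cases "\<bar>t\<bar> \<le> 1")
    case True
    have "\<bar>g x * (D2 g x t / t\<^sup>2)\<bar> \<le> ((g x)\<^sup>2 + (D2 g x t / t\<^sup>2)\<^sup>2) / 2"
      by (rule abs_mult_le_sum_squares)
    also have "\<dots> \<le> 15 * M\<^sup>2 * weight x"
    proof -
      have "(a + b) / 2 \<le> 15 * m" if "a \<le> 5 * m" "b \<le> 20 * m" "0 \<le> m" for a b m :: real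
        using that by simp
      from this[OF g_sq_bound[unfolded mult.assoc] D2g_sq_bound[unfolded mult.assoc] M2_weight_nonneg]
      show ?thesis by (simp only: mult.assoc)
    qed
    also have "\<dots> \<le> 15 * M\<^sup>2 * (1 * weight x + 1 * weight (x + t) + 1 * weight (x - t))"
      using weight_pos[of "x+t"] weight_pos[of "x-t"] by (intro mult_left_mono) auto
    finally show ?thesis by (rule mono) (rule weight_ge_half[OF True])
  next
    case False
    have "\<bar>g x * D2 g x t\<bar> \<le> 2 * (g x)\<^sup>2 + \<bar>g x * g (x + t)\<bar> + \<bar>g x * g (x - t)\<bar>"
    proof -
      have "\<bar>2 * s - a - b\<bar> \<le> 2 * s + \<bar>a\<bar> + \<bar>b\<bar>" if "0 \<le> s" for s a b :: real
        using that by linarith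
      moreover have "g x * D2 g x t = 2 * (g x)\<^sup>2 - g x * g (x + t) - g x * g (x - t)"
        by (simp add: D2_def algebra_simps power2_eq_square)
      ultimately show ?thesis by simp
    qed
    also have "\<dots> \<le> 2 * (g x)\<^sup>2 + ((g x)\<^sup>2 + (g (x + t))\<^sup>2) / 2 + ((g x)\<^sup>2 + (g (x - t))\<^sup>2) / 2"
      by (intro add_mono abs_mult_le_sum_squares order_refl)
    also have "\<dots> \<le> 15 * M\<^sup>2 * (weight x + weight (x + t) + weight (x - t))"
    proof -
      have "2 * a + (a + b) / 2 + (a + c) / 2 \<le> 3 * (l + m + n)"
        if "a \<le> l" "b \<le> m" "c \<le> n" "0 \<le> b" "0 \<le> c" for a b c l m n :: real
        using that by (simp add: field_simps)
      from this[OF g_sq_bound g_sq_bound g_sq_bound] show ?thesis by (simp add: distrib_left mult.assoc)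
    qed
    finally have "\<bar>g x * D2 g x t\<bar> * (1 / t\<^sup>2) \<le> 15 * M\<^sup>2 * (weight x + weight (x + t) + weight (x - t)) * (1 / t\<^sup>2)"
      by (rule mult_right_mono) simp
    then have "\<bar>g x * (D2 g x t / t\<^sup>2)\<bar> \<le> 15 * M\<^sup>2 * (1 / t\<^sup>2 * weight x + 1 / t\<^sup>2 * weight (x + t) + 1 / t\<^sup>2 * weight (x - t))"
      by (simp add: abs_mult algebra_simps add_divide_distrib)
    then show ?thesis by (rule mono) (use False in \<open>auto intro!: inverse_square_le_weight\<close>)
  qed
qed

lemma measurable_pair_D2 [measurable]:
  assumes [measurable]: "v \<in> borel_measurable borel"
  shows "(\<lambda>p. D2 v (fst p) (snd p)) \<in> borel_measurable (lborel \<Otimes>\<^sub>M lborel)"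
  unfolding D2_def by measurable

lemma integrable_LamI_g_kernel:
  "integrable (lborel \<Otimes>\<^sub>M lborel) (\<lambda>(x, t). g x * (D2 g x t / t\<^sup>2))"
proof (rule Bochner_Integration.integrable_bound)
  show "integrable (lborel \<Otimes>\<^sub>M lborel) (\<lambda>(x, t). 30 * M\<^sup>2 * (weight x * weight t + weight t * weight (x + t) + weight t * weight (x - t)))"
    using integrable_product[OF integrable_weight integrable_weight]
      integrable_product_shear_t[OF integrable_weight integrable_weight, of 1, simplified]
      integrable_product_shear_t[OF integrable_weight integrable_weight, of "-1", simplified]
    unfolding split_beta' by (intro integrable_mult_right Bochner_Integration.integrable_add)
  show "(\<lambda>(x, t). g x * (D2 g x t / t\<^sup>2)) \<in> borel_measurable (lborel \<Otimes>\<^sub>M lborel)"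
    unfolding case_prod_beta by measurable
  show "AE p in lborel \<Otimes>\<^sub>M lborel. norm (case p of (x, t) \<Rightarrow> g x * (D2 g x t / t\<^sup>2))
      \<le> norm (case p of (x, t) \<Rightarrow> 30 * M\<^sup>2 * (weight x * weight t + weight t * weight (x + t) + weight t * weight (x - t)))"
    using order_trans[OF LamI_g_kernel_bound abs_ge_self] by (intro AE_I2) auto
qed

lemma integrable_g_LamI_g: "integrable lborel (\<lambda>x. g x * LamI g x)"
proof -
  have "g x * LamI g x = 1 / (2 * pi) * (LINT t|lborel. g x * (D2 g x t / t\<^sup>2))" for x
    unfolding LamI_def integral_mult_right_zero by (rule mult.left_commute)
  then show ?thesis
    using lborel_pair.integrable_fst[OF integrable_LamI_g_kernel, unfolded prod.case]
    by (simp only: integrable_mult_right)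
qed

lemma integrable_g_mult_g: "integrable lborel (\<lambda>x. g x * g (x + t))"
proof (rule Bochner_Integration.integrable_bound)
  show "integrable lborel (\<lambda>x. 5 * M\<^sup>2 * (weight x + weight (x + t)))"
    using integrable_weight integrable_lborel_shift[of weight t] by simp
  show "AE x in lborel. norm (g x * g (x + t)) \<le> norm (5 * M\<^sup>2 * (weight x + weight (x + t)))"
  proof (rule AE_I2)
    fix x
    have "\<bar>g x * g (x + t)\<bar> \<le> ((g x)\<^sup>2 + (g (x + t))\<^sup>2) / 2"
      by (rule abs_mult_le_sum_squares)
    also have "\<dots> \<le> (g x)\<^sup>2 + (g (x + t))\<^sup>2" by simp
    also have "\<dots> \<le> 5 * M\<^sup>2 * weight x + 5 * M\<^sup>2 * weight (x + t)"
      by (intro add_mono g_sq_bound)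
    finally have "\<bar>g x * g (x + t)\<bar> \<le> 5 * M\<^sup>2 * (weight x + weight (x + t))"
      by (simp only: distrib_left)
    then show "norm (g x * g (x + t)) \<le> norm (5 * M\<^sup>2 * (weight x + weight (x + t)))" by simp
  qed
qed measurable

text \<open>By translation invariance the integral equals that of
  \<open>(g (x + t) - g x)\<^sup>2\<close>, the Gagliardo form at fixed \<open>t\<close>.\<close>

lemma integral_g_D2g_nonneg: "0 \<le> (LINT x|lborel. g x * D2 g x t)"
proof -
  define A where "A = (LINT x|lborel. g x * g x)"
  define B where "B s = (LINT x|lborel. g x * g (x + s))" for s
  have i: "integrable lborel (\<lambda>x. g x * g x)" "integrable lborel (\<lambda>x. g x * g (x + s))" for s
    using integrable_g_mult_g[of 0] integrable_g_mult_g by auto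
  have A_t: "(LINT x|lborel. g (x + t) * g (x + t)) = A" "integrable lborel (\<lambda>x. g (x + t) * g (x + t))"
    using integral_lborel_shift[of "\<lambda>x. g x * g x" t] integrable_lborel_shift[of "\<lambda>x. g x * g x" t] i by (simp_all add: A_def)
  have B: "B (- t) = B t"
    using integral_lborel_shift[of "\<lambda>x. g x * g (x - t)" t] by (simp add: B_def mult.commute)
  have "(LINT x|lborel. g x * D2 g x t) = (LINT x|lborel. 2 * (g x * g x) - g x * g (x + t) - g x * g (x + (- t)))"
    by (simp add: D2_def algebra_simps)
  also have "\<dots> = 2 * A - B t - B (- t)"
    using i by (simp add: A_def B_def del: add_uminus_conv_diff)
  also have "\<dots> = 2 * A - 2 * B t" using B by simp
  also have "\<dots> = (LINT x|lborel. g (x + t) * g (x + t) + g x * g x - 2 * (g x * g (x + t)))"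
    using i A_t by (simp add: A_def B_def)
  also have "\<dots> = (LINT x|lborel. (g (x + t) - g x)\<^sup>2)"
    by (simp add: power2_eq_square algebra_simps)
  also have "0 \<le> \<dots>" by simp
  finally show ?thesis .
qed

text \<open>\<open>hdot_half\<close> is a square root, and squaring it returns the integral because
  of this sign. Fubini reduces the claim to fixed \<open>t\<close>.\<close>

lemma integral_g_LamI_g_nonneg: "0 \<le> (LINT x|lborel. g x * LamI g x)"
proof -
  have "2 * pi * (LINT x|lborel. g x * LamI g x) = (LINT x|lborel. 2 * pi * (g x * LamI g x))"
    by (rule integral_mult_right_zero[symmetric])
  also have "\<dots> = (LINT x|lborel. LINT t|lborel. g x * (D2 g x t / t\<^sup>2))"
    unfolding integral_eq_LamI integral_mult_right_zero[of "lborel :: real measure" "g _"]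
    by (intro Bochner_Integration.integral_cong) simp_all
  also have "\<dots> = (LINT t|lborel. LINT x|lborel. g x * (D2 g x t / t\<^sup>2))"
    by (rule lborel_pair.Fubini_integral[OF integrable_LamI_g_kernel, symmetric])
  also have "\<dots> = (LINT t|lborel. (LINT x|lborel. g x * D2 g x t) / t\<^sup>2)" by simp
  also have "\<dots> \<ge> 0"
    using integral_g_D2g_nonneg by (intro Bochner_Integration.integral_nonneg) auto
  finally show ?thesis using pi_gt_zero unfolding zero_le_mult_iff by linarith
qed

text \<open>The Hilbert kernel folded over t and -t: its integral in \<open>t\<close> is 2 pi Hg(x)
  in the sign convention of \<open>hilbert\<close>.\<close>

definition "Hk x t = (g (x + t) - g (x - t)) / t"

lemma Hk_eq: "Hk x t = x * (D2 g x t / t\<^sup>2) - D2 f x t / t\<^sup>2"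
proof (cases "t = 0")
  case False
  have "x * D2 g x t / t\<^sup>2 = D2 f x t / t\<^sup>2 + Hk x t"
    unfolding x_D2g Hk_def using False by (simp add: field_simps power2_eq_square)
  then show ?thesis by simp
qed (simp add: Hk_def)

text \<open>The commutator relation divided by t^2 and integrated. From here on Hg is represented by
  \<open>x * LamI g x - L x\<close>, so that every integral is an ordinary Lebesgue
  integral.\<close>

lemma integrable_Hk: "integrable lborel (Hk x)"
  and integral_Hk: "(LINT t|lborel. Hk x t) = 2 * pi * (x * LamI g x - L x)"
proof -
  note int = integrable_mult_right[OF int_D2g, of x x]
  show "integrable lborel (Hk x)"
    unfolding Hk_eq[abs_def] by (rule Bochner_Integration.integrable_diff[OF int int_D2f])
  have "(LINT t|lborel. Hk x t) = x * (2 * pi * LamI g x) - 2 * pi * L x"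
    unfolding Hk_eq Bochner_Integration.integral_diff[OF int int_D2f] integral_mult_right_zero integral_eq_LamI ..
  then show "(LINT t|lborel. Hk x t) = 2 * pi * (x * LamI g x - L x)" by (simp add: algebra_simps)
qed

text \<open>For |t| \<le> 1 the Lipschitz bound on \<open>g\<close> gives 2 M, doubled by passing to
  \<open>weight t\<close>. For larger |t| neither \<open>g (x + t)\<close> nor 1/t need be
  integrable in \<open>t\<close>, but both squares are; these give the 5 M^2 and the 2.\<close>

lemma Hk_bound: "\<bar>Hk x t\<bar> \<le> (4 * M + 5 * M\<^sup>2 + 2) * (weight t + weight (x + t) + weight (x - t))"
proof (cases "\<bar>t\<bar> \<le> 1")
  case True
  have "\<bar>Hk x t\<bar> \<le> 2 * M * 1"
    using lipg[of "x + t" "x - t"] M_nonneg by (cases "t = 0") (auto simp: Hk_def abs_divide divide_le_eq)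
  also have "\<dots> \<le> 2 * M * (2 * weight t)" using M_nonneg weight_ge_half[OF True] by (intro mult_left_mono) auto
  also have "\<dots> = 4 * M * (weight t + 0 + 0)" by simp
  also have "\<dots> \<le> (4 * M + 5 * M\<^sup>2 + 2) * (weight t + weight (x + t) + weight (x - t))"
    using M_nonneg weight_pos[of t] weight_pos[of "x+t"] weight_pos[of "x-t"] by (intro mult_mono add_mono) auto
  finally show ?thesis .
next
  case False
  have "\<bar>Hk x t\<bar> \<le> \<bar>g (x + t) * (1 / t)\<bar> + \<bar>g (x - t) * (1 / t)\<bar>"
    unfolding Hk_def diff_divide_distrib
    using abs_triangle_ineq4[of "g (x + t) / t" "g (x - t) / t"] by (simp add: abs_mult abs_divide)
  also have "\<dots> \<le> ((g (x + t))\<^sup>2 + (1 / t)\<^sup>2) / 2 + ((g (x - t))\<^sup>2 + (1 / t)\<^sup>2) / 2"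
    by (intro add_mono abs_mult_le_sum_squares)
  also have "\<dots> \<le> 5 * M\<^sup>2 * weight (x + t) + 5 * M\<^sup>2 * weight (x - t) + 2 * weight t"
  proof -
    have "(a + c) / 2 + (b + c) / 2 \<le> m + n + k" if "a \<le> m" "b \<le> n" "c \<le> k" "0 \<le> a" "0 \<le> b" for a b c m n k :: real
      using that by (simp add: field_simps)
    moreover have "(1 / t)\<^sup>2 \<le> 2 * weight t" using inverse_square_le_weight[of t] False by (simp add: power_divide)
    ultimately show ?thesis using g_sq_bound[of "x + t"] g_sq_bound[of "x - t"] by simp
  qed
  also have "\<dots> \<le> (4 * M + 5 * M\<^sup>2 + 2) * weight (x + t) + (4 * M + 5 * M\<^sup>2 + 2) * weight (x - t) + (4 * M + 5 * M\<^sup>2 + 2) * weight t"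
    using M_nonneg weight_pos by (intro add_mono mult_right_mono less_imp_le[OF weight_pos]) auto
  finally show ?thesis by (simp add: algebra_simps)
qed

end

section \<open>Cotlar's identity at a fixed scale\<close>

locale C3b_scale = C3b +
  fixes d :: real assumes d: "0 < d"
begin

definition "K x = cpoisson d x * g x"
definition "P x = poisson d x * g x"

lemma measKP [measurable]: "K \<in> borel_measurable borel" "P \<in> borel_measurable borel"
  unfolding K_def P_def by measurable

text \<open>The numerator of \<open>cpoisson\<close> meets \<open>g\<close> in
  \<open>x * g x = f x - f 0\<close>, which is at most 2 M; this makes \<open>K\<close> integrable
  although \<open>cpoisson d\<close> is not.\<close>

lemma K_bound: "\<bar>K x\<bar> \<le> 2 * M / d * poisson d x"
proof -
  have "\<bar>x * g x\<bar> \<le> 2 * M" unfolding x_g using bd0[of x] bd0[of 0] by linarith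
  then have "\<bar>x * g x\<bar> / (x\<^sup>2 + d\<^sup>2) \<le> 2 * M / (x\<^sup>2 + d\<^sup>2)" by (intro divide_right_mono) auto
  then show ?thesis using d sum_squares_pos[OF d, of x] by (simp add: K_def cpoisson_def poisson_def abs_mult abs_divide)
qed

lemma integrable_K: "integrable lborel K"
  by (rule Bochner_Integration.integrable_bound[OF integrable_mult_right[OF integrable_poisson[OF d], of "2 * M / d"]])
     (use order_trans[OF K_bound abs_ge_self] in auto)

lemma integrable_P: "integrable lborel P"
  unfolding P_def by (rule integrable_mult_bounded[OF integrable_poisson[OF d] _ bdg]) measurable

text \<open>Real part of 1/z - 1/w = (w - z)/(z w) for z = x + i d and w = z + t, multiplied by
  \<open>g x * g (x + t)\<close>. The division by \<open>t\<close> disappears and products of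
  integrable functions remain.\<close>

lemma kernel_identity:
  assumes "t \<noteq> 0"
  shows "(K x * g (x + t) - K (x + t) * g x) / t = K x * K (x + t) - P x * P (x + t)"
proof -
  have "(cpoisson d x - cpoisson d (x + t)) / t = cpoisson d x * cpoisson d (x + t) - poisson d x * poisson d (x + t)"
  proof -
    define A where "A = x\<^sup>2 + d\<^sup>2"
    define B where "B = (x + t)\<^sup>2 + d\<^sup>2"
    have "x * B - (x + t) * A = t * (x * (x + t) - d * d)"
      by (simp add: A_def B_def algebra_simps power2_eq_square)
    moreover have "A \<noteq> 0" "B \<noteq> 0"
      using sum_squares_pos[OF d, of x] sum_squares_pos[OF d, of "x + t"] unfolding A_def B_def by linarith+
    ultimately show ?thesis
      using assms unfolding cpoisson_def poisson_def A_def[symmetric] B_def[symmetric]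
      by (simp add: divide_simps)
  qed
  then have "g x * g (x + t) * ((cpoisson d x - cpoisson d (x + t)) / t)
     = g x * g (x + t) * (cpoisson d x * cpoisson d (x + t) - poisson d x * poisson d (x + t))" by simp
  then show ?thesis by (simp add: K_def P_def algebra_simps diff_divide_distrib)
qed

lemma integrable_K_Hk: "integrable (lborel \<Otimes>\<^sub>M lborel) (\<lambda>(x, t). K x * Hk x t)"
proof (rule Bochner_Integration.integrable_bound)
  let ?C = "2 * M / d * (4 * M + 5 * M\<^sup>2 + 2)"
  show "integrable (lborel \<Otimes>\<^sub>M lborel) (\<lambda>(x, t). ?C * (poisson d x * weight t + poisson d x * weight (x + t) + poisson d x * weight (x - t)))"
    using integrable_product[OF integrable_poisson[OF d] integrable_weight]
      integrable_product_shear[OF integrable_poisson[OF d] integrable_weight, of 1, simplified]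
      integrable_product_shear[OF integrable_poisson[OF d] integrable_weight, of "-1", simplified]
    unfolding split_beta' by (intro integrable_mult_right Bochner_Integration.integrable_add)
  show "(\<lambda>(x, t). K x * Hk x t) \<in> borel_measurable (lborel \<Otimes>\<^sub>M lborel)"
    unfolding case_prod_beta Hk_def by measurable
  have "\<bar>K x * Hk x t\<bar> \<le> ?C * (poisson d x * weight t + poisson d x * weight (x + t) + poisson d x * weight (x - t))" for x t
  proof -
    have "\<bar>K x * Hk x t\<bar> \<le> (2 * M / d * poisson d x) * ((4 * M + 5 * M\<^sup>2 + 2) * (weight t + weight (x + t) + weight (x - t)))"
      unfolding abs_mult using M_nonneg d poisson_nonneg[OF d] by (intro mult_mono K_bound Hk_bound) auto
    then show ?thesis by (simp add: algebra_simps)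
  qed
  then show "AE p in lborel \<Otimes>\<^sub>M lborel. norm (case p of (x, t) \<Rightarrow> K x * Hk x t)
      \<le> norm (case p of (x, t) \<Rightarrow> ?C * (poisson d x * weight t + poisson d x * weight (x + t) + poisson d x * weight (x - t)))"
    using order_trans[OF _ abs_ge_self] by (intro AE_I2) auto
qed

lemma integrable_K_Hg: "integrable lborel (\<lambda>x. K x * (x * LamI g x - L x))"
proof -
  have "K x * (x * LamI g x - L x) = 1 / (2 * pi) * (LINT t|lborel. K x * Hk x t)" for x
    unfolding integral_mult_right_zero integral_Hk by simp
  then show ?thesis
    using lborel_pair.integrable_fst[OF integrable_K_Hk, unfolded prod.case] by (simp only: integrable_mult_right)
qed

text \<open>The translation in \<open>x\<close> requires \<open>t\<close> as outer variable, the
  final factorisation requires it as inner one; hence two interchanges, with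
  \<open>kernel_identity\<close> between them.\<close>

lemma cotlar:
  "(LINT x|lborel. K x * (x * LamI g x - L x))
    = 1 / (2 * pi) * ((LINT x|lborel. K x)\<^sup>2 - (LINT x|lborel. P x)\<^sup>2)"
proof -
  have iKg: "integrable lborel (\<lambda>x. K x * g (x + t))" for t
    by (rule integrable_mult_bounded[OF integrable_K _ bdg]) measurable
  have "2 * pi * (LINT x|lborel. K x * (x * LamI g x - L x)) = (LINT x|lborel. LINT t|lborel. K x * Hk x t)"
    unfolding integral_Hk integral_mult_right_zero[of "lborel :: real measure" "K _"]
      integral_mult_right_zero[of "lborel :: real measure" "2 * pi", symmetric]
    by (intro Bochner_Integration.integral_cong) simp_all
  also have "\<dots> = (LINT t|lborel. LINT x|lborel. K x * Hk x t)"
    using lborel_pair.Fubini_integral[OF integrable_K_Hk] by simp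
  also have "\<dots> = (LINT t|lborel. LINT x|lborel. K x * K (x + t) - P x * P (x + t))"
  proof (rule integral_cong_AE)
    show "AE t in lborel. (LINT x|lborel. K x * Hk x t) = (LINT x|lborel. K x * K (x + t) - P x * P (x + t))"
      using AE_lborel_singleton[of 0]
    proof eventually_elim
      fix t :: real assume t: "t \<noteq> 0"
      \<comment> \<open>Shifting \<open>x\<close> by \<open>t\<close> transfers the increment from
        \<open>g\<close> to \<open>K\<close>, which produces the antisymmetric numerator of
        \<open>kernel_identity\<close>.\<close>
      have s: "(LINT x|lborel. K x * g (x - t)) = (LINT x|lborel. K (x + t) * g x)"
        using integral_lborel_shift[of "\<lambda>x. K x * g (x - t)" t] by simp
      have i: "integrable lborel (\<lambda>x. K (x + t) * g x)"
        using integrable_lborel_shift[of "\<lambda>x. K x * g (x - t)" t] iKg[of "-t"] by simp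
      have "(LINT x|lborel. K x * Hk x t) = (LINT x|lborel. (K x * g (x + t) - K x * g (x - t)) / t)"
        by (simp add: Hk_def algebra_simps)
      also have "\<dots> = (LINT x|lborel. (K x * g (x + t) - K (x + t) * g x) / t)"
        using iKg[of t] iKg[of "-t"] i s by (simp add: Bochner_Integration.integral_diff)
      finally show "(LINT x|lborel. K x * Hk x t) = (LINT x|lborel. K x * K (x + t) - P x * P (x + t))"
        by (simp add: kernel_identity[OF t])
    qed
  qed (simp_all add: Hk_def)
  also have "\<dots> = (LINT x|lborel. LINT t|lborel. K x * K (x + t) - P x * P (x + t))"
  proof -
    \<comment> \<open>Once the factor 1/t has cancelled, the two products are separately integrable,
      each as a sheared tensor product.\<close>
    have "integrable (lborel \<Otimes>\<^sub>M lborel) (\<lambda>(x, t). K x * K (x + t) - P x * P (x + t))"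
      using integrable_product_shear[OF integrable_K integrable_K, of 1]
        integrable_product_shear[OF integrable_P integrable_P, of 1]
      unfolding split_beta' by (intro Bochner_Integration.integrable_diff) simp_all
    from lborel_pair.Fubini_integral[OF this] show ?thesis .
  qed
  also have "\<dots> = (LINT x|lborel. K x * (LINT t|lborel. K t) - P x * (LINT t|lborel. P t))"
  proof (rule Bochner_Integration.integral_cong[OF refl])
    fix x
    have *: "integrable lborel (\<lambda>t. K (x + t))" "integrable lborel (\<lambda>t. P (x + t))"
      "(LINT t|lborel. K (x + t)) = (LINT t|lborel. K t)" "(LINT t|lborel. P (x + t)) = (LINT t|lborel. P t)"
      using integrable_lborel_shift[of K x] integrable_lborel_shift[of P x] integrable_K integrable_P
        integral_lborel_shift[of K x] integral_lborel_shift[of P x] by (simp_all add: add.commute)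
    then show "(LINT t|lborel. K x * K (x + t) - P x * P (x + t)) = K x * (LINT t|lborel. K t) - P x * (LINT t|lborel. P t)"
      by simp
  qed
  also have "\<dots> = (LINT x|lborel. K x)\<^sup>2 - (LINT x|lborel. P x)\<^sup>2"
    using integrable_K integrable_P by (simp add: power2_eq_square)
  finally show ?thesis by (simp add: field_simps)
qed

lemma integrable_KL: "integrable lborel (\<lambda>x. K x * L x)"
  by (rule integrable_mult_bounded[OF integrable_K _ bdL]) measurable

text \<open>\<open>L\<close> is written as x \<Lambda>g - Hg. The factor \<open>x\<close> turns the
  kernel into x^2/(x^2 + d^2), which tends to 1: this is where the seminorm integral comes from. The
  Hg term is evaluated by \<open>cotlar\<close>.\<close>

lemma regularised_identity:
  "(LINT x|lborel. K x * L x) = (LINT x|lborel. x\<^sup>2 / (x\<^sup>2 + d\<^sup>2) * (g x * LamI g x))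
    - 1 / (2 * pi) * ((LINT x|lborel. K x)\<^sup>2 - (LINT x|lborel. P x)\<^sup>2)"
proof -
  have "(LINT x|lborel. K x * L x) + (LINT x|lborel. K x * (x * LamI g x - L x))
      = (LINT x|lborel. K x * L x + K x * (x * LamI g x - L x))"
    by (rule Bochner_Integration.integral_add[symmetric, OF integrable_KL integrable_K_Hg])
  also have "\<dots> = (LINT x|lborel. x\<^sup>2 / (x\<^sup>2 + d\<^sup>2) * (g x * LamI g x))"
    by (intro Bochner_Integration.integral_cong) (simp_all add: right_diff_distrib K_def cpoisson_def power2_eq_square)
  finally show ?thesis using cotlar by linarith
qed

end

section \<open>Poisson and conjugate Poisson integrals as the scale tends to 0\<close>

lemma integral_poisson_scaled:
  assumes "0 < d"
  shows "(LINT x|lborel. poisson d x * v x) = (LINT u|lborel. weight u * v (d * u))"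
proof -
  have "(LINT x|lborel. poisson d x * v x) = d * (LINT u|lborel. poisson d (d * u) * v (d * u))"
    using lborel_integral_real_affine[of d "\<lambda>x. poisson d x * v x" 0] assms by simp
  also have "\<dots> = (LINT u|lborel. d * (poisson d (d * u) * v (d * u)))" by simp
  also have "\<dots> = (LINT u|lborel. weight u * v (d * u))"
  proof (rule Bochner_Integration.integral_cong[OF refl])
    fix u
    have "(d * u)\<^sup>2 + d\<^sup>2 = d\<^sup>2 * (1 + u\<^sup>2)" by (simp add: algebra_simps power_mult_distrib)
    then show "d * (poisson d (d * u) * v (d * u)) = weight u * v (d * u)"
      using assms by (simp add: poisson_def[of d] weight_eq power2_eq_square)
  qed
  finally show ?thesis .
qed

text \<open>An approximate identity of mass pi: after rescaling, only the argument of
  \<open>v\<close> depends on the scale.\<close>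

lemma tendsto_integral_poisson:
  fixes v :: "real \<Rightarrow> real"
  assumes v: "continuous_on UNIV v" "\<And>x. \<bar>v x\<bar> \<le> B" and d: "\<And>n. 0 < d n" "d \<longlonglongrightarrow> 0"
  shows "(\<lambda>n. LINT x|lborel. poisson (d n) x * v x) \<longlonglongrightarrow> pi * v 0"
proof -
  have [measurable]: "v \<in> borel_measurable borel" using v(1) by (rule borel_measurable_continuous_onI)
  have "(\<lambda>n. LINT u|lborel. weight u * v (d n * u)) \<longlonglongrightarrow> (LINT u|lborel. weight u * v 0)"
  proof (rule integral_dominated_convergence[where w="\<lambda>u. weight u * B"])
    show "AE u in lborel. (\<lambda>n. weight u * v (d n * u)) \<longlonglongrightarrow> weight u * v 0"
    proof (rule AE_I2)
      fix u :: real
      have "(\<lambda>n. d n * u) \<longlonglongrightarrow> 0 * u" using d(2) by (intro tendsto_intros)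
      then have "(\<lambda>n. v (d n * u)) \<longlonglongrightarrow> v 0"
        using v(1) by (intro isCont_tendsto_compose[of _ v]) (auto simp: continuous_on_eq_continuous_at)
      then show "(\<lambda>n. weight u * v (d n * u)) \<longlonglongrightarrow> weight u * v 0" by (intro tendsto_intros)
    qed
    show "AE u in lborel. norm (weight u * v (d n * u)) \<le> weight u * B" for n
      using v(2) weight_pos by (intro AE_I2) (simp add: abs_mult less_imp_le mult_left_mono)
  qed (use integrable_weight in auto)
  then show ?thesis using integral_poisson_scaled[OF d(1), of _ v] integral_poisson[of 1] by simp
qed

text \<open>The limit is a principal value. Since \<open>cpoisson\<close> is odd, only
  \<open>v x - v (- x)\<close> counts, and \<open>cpoisson_le_inverse\<close> makes the absolute
  value of the limit integrand a majorant.\<close>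

lemma tendsto_integral_cpoisson:
  fixes v :: "real \<Rightarrow> real"
  assumes v: "v \<in> borel_measurable borel" and d: "d \<longlonglongrightarrow> 0"
    and int: "\<And>n. integrable lborel (\<lambda>x. cpoisson (d n) x * v x)"
    and odd: "integrable lborel (\<lambda>x. (v x - v (- x)) / x)"
  shows "(\<lambda>n. LINT x|lborel. cpoisson (d n) x * v x) \<longlonglongrightarrow> (LINT x|lborel. (v x - v (- x)) / x) / 2"
proof -
  note [measurable] = v
  have "(\<lambda>n. LINT x|lborel. cpoisson (d n) x * (v x - v (- x))) \<longlonglongrightarrow> (LINT x|lborel. (v x - v (- x)) / x)"
  proof (rule integral_dominated_convergence[where w="\<lambda>x. \<bar>(v x - v (- x)) / x\<bar>"])
    show "AE x in lborel. (\<lambda>n. cpoisson (d n) x * (v x - v (- x))) \<longlonglongrightarrow> (v x - v (- x)) / x"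
    proof (rule AE_I2)
      fix x
      show "(\<lambda>n. cpoisson (d n) x * (v x - v (- x))) \<longlonglongrightarrow> (v x - v (- x)) / x"
        using tendsto_mult[OF tendsto_cpoisson[OF d, of x] tendsto_const[of "v x - v (- x)"]] by simp
    qed
    show "AE x in lborel. norm (cpoisson (d n) x * (v x - v (- x))) \<le> \<bar>(v x - v (- x)) / x\<bar>" for n
    proof (rule AE_I2)
      fix x
      show "norm (cpoisson (d n) x * (v x - v (- x))) \<le> \<bar>(v x - v (- x)) / x\<bar>"
        using mult_right_mono[OF cpoisson_le_inverse[of "d n" x], of "\<bar>v x - v (- x)\<bar>"] by (simp add: abs_mult abs_divide)
    qed
  qed (use odd integrable_abs[OF odd] in simp_all)
  moreover have "(LINT x|lborel. cpoisson (d n) x * (v x - v (- x))) = 2 * (LINT x|lborel. cpoisson (d n) x * v x)" for n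
    unfolding integral_even_part[OF int] cpoisson_minus by (simp add: right_diff_distrib)
  ultimately show ?thesis
    using tendsto_mult_left[of "\<lambda>n. 2 * (LINT x|lborel. cpoisson (d n) x * v x)" _ _ "1/2"] by simp
qed

section \<open>The principal value of (g L)/x at 0\<close>

context C3b begin

text \<open>The scale becomes an explicit argument, so that it can run through a sequence.\<close>

lemma regularised_identity_d:
  assumes d: "0 < d"
  shows "(LINT x|lborel. cpoisson d x * (g x * L x)) = (LINT x|lborel. x\<^sup>2 / (x\<^sup>2 + d\<^sup>2) * (g x * LamI g x))
    - 1 / (2 * pi) * ((LINT x|lborel. cpoisson d x * g x)\<^sup>2 - (LINT x|lborel. poisson d x * g x)\<^sup>2)"
    and integrable_cpoisson_g: "integrable lborel (\<lambda>x. cpoisson d x * g x)"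
    and integrable_cpoisson_gL: "integrable lborel (\<lambda>x. cpoisson d x * (g x * L x))"
proof -
  interpret C3b_scale f f1 f2 f3 M d
    by unfold_locales (rule d)
  show "(LINT x|lborel. cpoisson d x * (g x * L x)) = (LINT x|lborel. x\<^sup>2 / (x\<^sup>2 + d\<^sup>2) * (g x * LamI g x))
    - 1 / (2 * pi) * ((LINT x|lborel. cpoisson d x * g x)\<^sup>2 - (LINT x|lborel. poisson d x * g x)\<^sup>2)"
    using regularised_identity unfolding K_def P_def mult.assoc .
  show "integrable lborel (\<lambda>x. cpoisson d x * g x)"
    using integrable_K unfolding K_def .
  show "integrable lborel (\<lambda>x. cpoisson d x * (g x * L x))"
    using integrable_KL unfolding K_def mult.assoc .
qed

definition "N x = g x * L x - g (- x) * L (- x)"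

text \<open>\<open>L\<close> is bounded but need not decay. Near 0 the Lipschitz bounds on
  \<open>g\<close> and \<open>L\<close> give 12 M^2 |x|; at infinity \<open>x * g x\<close> is at
  most 2 M and \<open>L\<close> at most 3 M, which gives 12 M^2 / |x|. Together 24 = 12 +
  12.\<close>

lemma N_bound: "\<bar>N x / x\<bar> \<le> 24 * M\<^sup>2 * weight x"
proof (cases "x = 0")
  case True
  then show ?thesis using weight_pos[of x] by simp
next
  case False
  have "N x = g x * (L x - L (- x)) + L (- x) * (g x - g (- x))"
    by (simp add: N_def algebra_simps)
  also have "\<bar>\<dots>\<bar> \<le> M * (3 * M * (2 * \<bar>x\<bar>)) + 3 * M * (M * (2 * \<bar>x\<bar>))"
    using M_nonneg lipL[of x "-x"] lipg[of x "-x"] bdg[of x] bdL[of "-x"]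
    by (intro order_trans[OF abs_triangle_ineq] add_mono) (simp_all only: abs_mult, (intro mult_mono; simp)+)
  finally have 1: "\<bar>N x\<bar> \<le> 12 * M\<^sup>2 * \<bar>x\<bar>" by (simp add: power2_eq_square)
  have xg: "\<bar>x * g x\<bar> \<le> 2 * M" "\<bar>x * g (- x)\<bar> \<le> 2 * M"
    using x_g[of x] x_g[of "-x"] bd0[of x] bd0[of "-x"] bd0[of 0] by auto
  have "x * N x = (x * g x) * L x - (x * g (- x)) * L (- x)"
    by (simp add: N_def algebra_simps)
  also have "\<bar>\<dots>\<bar> \<le> (2 * M) * (3 * M) + (2 * M) * (3 * M)"
  proof (intro order_trans[OF abs_triangle_ineq4] add_mono)
    show "\<bar>x * g x * L x\<bar> \<le> 2 * M * (3 * M)" "\<bar>x * g (- x) * L (- x)\<bar> \<le> 2 * M * (3 * M)"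
      unfolding abs_mult[of "x * g x"] abs_mult[of "x * g (- x)"] using M_nonneg by (intro mult_mono xg bdL; simp)+
  qed
  finally have 2: "\<bar>x\<bar> * \<bar>N x\<bar> \<le> 12 * M\<^sup>2" by (simp add: power2_eq_square abs_mult)
  have "\<bar>N x\<bar> * (1 + x\<^sup>2) \<le> 24 * M\<^sup>2 * \<bar>x\<bar>"
    using 1 mult_left_mono[OF 2, of "\<bar>x\<bar>"] by (simp add: algebra_simps power2_eq_square abs_mult_self_eq flip: abs_mult)
  then show ?thesis using False
    by (simp add: weight_eq abs_divide pos_le_divide_eq pos_divide_le_eq add_pos_nonneg)
qed

lemma integrable_N: "integrable lborel (\<lambda>x. N x / x)"
proof (rule Bochner_Integration.integrable_bound)
  show "integrable lborel (\<lambda>x. 24 * M\<^sup>2 * weight x)" using integrable_weight by simp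
  show "AE x in lborel. norm (N x / x) \<le> norm (24 * M\<^sup>2 * weight x)"
    using order_trans[OF N_bound abs_ge_self] by (intro AE_I2) auto
qed (unfold N_def, measurable)

lemma integral_N:
  "(LINT x|lborel. N x / x) = 2 * (LINT x|lborel. g x * LamI g x) - pi * (L 0)\<^sup>2 + pi * (f1 0)\<^sup>2"
proof -
  define d where "d n = inverse (real (Suc n))" for n
  have d: "0 < d n" "d \<longlonglongrightarrow> 0" for n
    unfolding d_def using LIMSEQ_inverse_real_of_nat by simp_all
  have 1: "(\<lambda>n. LINT x|lborel. cpoisson (d n) x * (g x * L x)) \<longlonglongrightarrow> (LINT x|lborel. N x / x) / 2"
    unfolding N_def
    by (rule tendsto_integral_cpoisson[OF _ d(2) integrable_cpoisson_gL[OF d(1)]]) (use integrable_N in \<open>simp_all add: N_def\<close>)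
  \<comment> \<open>At x = 0 the commutator relation reads Hg(0) = - L 0, so (Hg(0))^2 becomes the
    square of \<Lambda>f(0).\<close>
  have 2: "(\<lambda>n. LINT x|lborel. cpoisson (d n) x * g x) \<longlonglongrightarrow> - pi * L 0"
  proof -
    have "(\<lambda>n. LINT x|lborel. cpoisson (d n) x * g x) \<longlonglongrightarrow> (LINT x|lborel. (g x - g (- x)) / x) / 2"
      by (rule tendsto_integral_cpoisson[OF _ d(2) integrable_cpoisson_g[OF d(1)]]) (use integrable_Hk[of 0] in \<open>simp_all add: Hk_def[abs_def]\<close>)
    moreover have "(LINT x|lborel. (g x - g (- x)) / x) = - 2 * pi * L 0"
      using integral_Hk[of 0] by (simp add: Hk_def)
    ultimately show ?thesis by simp
  qed
  have 3: "(\<lambda>n. LINT x|lborel. poisson (d n) x * g x) \<longlonglongrightarrow> pi * g 0"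
    by (rule tendsto_integral_poisson[OF contg bdg d])
  have 4: "(\<lambda>n. LINT x|lborel. x\<^sup>2 / (x\<^sup>2 + (d n)\<^sup>2) * (g x * LamI g x)) \<longlonglongrightarrow> (LINT x|lborel. g x * LamI g x)"
  proof (rule integral_dominated_convergence[where w="\<lambda>x. \<bar>g x * LamI g x\<bar>"])
    show "AE x in lborel. (\<lambda>n. x\<^sup>2 / (x\<^sup>2 + (d n)\<^sup>2) * (g x * LamI g x)) \<longlonglongrightarrow> g x * LamI g x"
      using AE_lborel_singleton[of 0]
    proof eventually_elim
      fix x :: real assume "x \<noteq> 0"
      then have "(\<lambda>n. x\<^sup>2 / (x\<^sup>2 + (d n)\<^sup>2) * (g x * LamI g x)) \<longlonglongrightarrow> x\<^sup>2 / (x\<^sup>2 + 0\<^sup>2) * (g x * LamI g x)"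
        using d(2) by (intro tendsto_intros) auto
      then show "(\<lambda>n. x\<^sup>2 / (x\<^sup>2 + (d n)\<^sup>2) * (g x * LamI g x)) \<longlonglongrightarrow> g x * LamI g x"
        using \<open>x \<noteq> 0\<close> by simp
    qed
    show "AE x in lborel. norm (x\<^sup>2 / (x\<^sup>2 + (d n)\<^sup>2) * (g x * LamI g x)) \<le> \<bar>g x * LamI g x\<bar>" for n
    proof (rule AE_I2)
      fix x
      have "\<bar>x\<^sup>2 / (x\<^sup>2 + (d n)\<^sup>2)\<bar> \<le> 1"
        using sum_squares_pos[OF d(1)[of n], of x] by (simp add: abs_divide divide_le_eq)
      then show "norm (x\<^sup>2 / (x\<^sup>2 + (d n)\<^sup>2) * (g x * LamI g x)) \<le> \<bar>g x * LamI g x\<bar>"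
        unfolding real_norm_def abs_mult[of "x\<^sup>2 / (x\<^sup>2 + (d n)\<^sup>2)"] by (rule mult_left_le_one_le[rotated 2]) auto
    qed
    have [measurable]: "(\<lambda>x. g x * LamI g x) \<in> borel_measurable borel"
      using borel_measurable_integrable[OF integrable_g_LamI_g] by simp
    show "(\<lambda>x. x\<^sup>2 / (x\<^sup>2 + (d n)\<^sup>2) * (g x * LamI g x)) \<in> borel_measurable lborel" for n
      by measurable
  qed (use integrable_g_LamI_g in auto)
  have "(\<lambda>n. LINT x|lborel. cpoisson (d n) x * (g x * L x)) \<longlonglongrightarrow> (LINT x|lborel. g x * LamI g x)
      - 1 / (2 * pi) * ((- pi * L 0)\<^sup>2 - (pi * g 0)\<^sup>2)"
    unfolding regularised_identity_d[OF d(1)] by (intro tendsto_intros 2 3 4)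
  from LIMSEQ_unique[OF 1 this]
  have "(LINT x|lborel. N x / x) / 2 = (LINT x|lborel. g x * LamI g x) - 1 / (2 * pi) * ((- pi * L 0)\<^sup>2 - (pi * g 0)\<^sup>2)" .
  \<comment> \<open>The other square in Cotlar's identity is g(0)^2, with g(0) = f'(0).\<close>
  moreover have "g 0 = f1 0" using der0[of 0, THEN DERIV_imp_deriv] by (simp add: diffquot_def)
  moreover have "1 / (2 * pi) * ((- pi * a)\<^sup>2 - (pi * b)\<^sup>2) = pi * a\<^sup>2 / 2 - pi * b\<^sup>2 / 2" for a b
    by (simp add: power_mult_distrib power2_eq_square field_simps)
  ultimately show ?thesis by (simp only:)
qed

end

section \<open>The square of the operator\<close>

text \<open>Since \<open>f3\<close> is merely bounded, the second difference of \<open>LamI f\<close> is not $O(t^2)$; interpolating between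
  the bounds on the mixed second differences of \<open>f\<close> gives the integrable majorant \<open>kap\<close> instead.\<close>

definition kap :: "real \<Rightarrow> real" where "kap s = 1 / (sqrt \<bar>s\<bar> * (1 + \<bar>s\<bar>))"

lemma kap_minus: "kap (- s) = kap s"
  by (simp add: kap_def)

lemma borel_measurable_kap [measurable]: "kap \<in> borel_measurable borel"
  unfolding kap_def by measurable

lemma integrable_kap: "integrable lborel kap"
proof -
  have der: "((\<lambda>s. 2 * arctan (sqrt s)) has_real_derivative kap s) (at s)" if "0 < s" for s
    using that unfolding kap_def by (auto intro!: derivative_eq_intros simp: divide_simps algebra_simps)
  have "set_integrable lborel (einterval 0 \<infinity>) kap"
  proof (rule interval_integral_FTC_nonneg(1)[where F="\<lambda>s. 2 * arctan (sqrt s)" and A=0 and B=pi])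
    show "isCont kap s" if "0 < ereal s" for s
      using that unfolding kap_def by (auto intro!: continuous_intros)
    have "isCont (\<lambda>s. 2 * arctan (sqrt s)) 0" by (intro continuous_intros)
    then have "((\<lambda>s. 2 * arctan (sqrt s)) \<longlongrightarrow> 0) (at 0)" by (simp add: isCont_def)
    then have "((\<lambda>s. 2 * arctan (sqrt s)) \<longlongrightarrow> 0) (at_right 0)"
      by (rule tendsto_mono[OF at_le, rotated]) simp
    then show "(((\<lambda>s. 2 * arctan (sqrt s)) \<circ> real_of_ereal) \<longlongrightarrow> 0) (at_right 0)"
      by (simp add: zero_ereal_def at_right_ereal filterlim_filtermap comp_def)
    have "((\<lambda>s. 2 * arctan (sqrt s)) \<longlongrightarrow> 2 * (pi / 2)) at_top"
      by (intro tendsto_intros filterlim_compose[OF tendsto_arctan_at_top] sqrt_at_top)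
    then show "(((\<lambda>s. 2 * arctan (sqrt s)) \<circ> real_of_ereal) \<longlongrightarrow> pi) (at_left \<infinity>)"
      by (simp add: at_left_PInf filterlim_filtermap comp_def)
  qed (use der in \<open>auto simp: kap_def\<close>)
  then have i: "integrable lborel (\<lambda>s. indicator {0<..} s * kap s)"
    by (simp add: set_integrable_def zero_ereal_def)
  then have "integrable lborel (\<lambda>s. indicator {0<..} s * kap s + indicator {0<..} (- s) * kap (- s))"
    using integrable_lborel_reflect[of "\<lambda>s. indicator {0<..} s * kap s"] by simp
  also have "(\<lambda>s. indicator {0<..} s * kap s + indicator {0<..} (- s) * kap (- s)) = kap"
    by (auto simp: fun_eq_iff indicator_def kap_minus kap_def)
  finally show ?thesis .
qed

text \<open>With r = sqrt |s| and q = sqrt |t|, the quantity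
  \<open>s\<^sup>2 * t\<^sup>2 * kap s * kap t\<close> is r^3 q^3 / ((1 + r^2)(1 + q^2)). Expanding
  the denominator gives four terms, each bounded by M r^3 q^3 through one of the three bounds on D;
  r \<le> q lets r^4 q^2 be replaced by r^3 q^3.\<close>

lemma min_bound_mono:
  fixes r q D M :: real
  assumes "0 \<le> r" "r \<le> q" "0 \<le> D" "0 \<le> M" and D: "D \<le> M" "D \<le> M * r ^ 4" "D \<le> M * q\<^sup>2 * r ^ 4"
  shows "D * ((1 + r\<^sup>2) * (1 + q\<^sup>2)) \<le> 4 * M * (r ^ 3 * q ^ 3)"
proof -
  have "r ^ 3 * r ^ 1 \<le> r ^ 3 * q ^ 1" "r ^ 3 * (r * q\<^sup>2) \<le> r ^ 3 * (q * q\<^sup>2)"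
    using assms by (auto intro!: mult_left_mono mult_right_mono)
  then have a: "q\<^sup>2 * r ^ 4 \<le> r ^ 3 * q ^ 3" by (simp add: power3_eq_cube power4_eq_xxxx power2_eq_square algebra_simps)
  have 1: "D \<le> M * (r ^ 3 * q ^ 3)"
    using D(3) mult_left_mono[OF a \<open>0 \<le> M\<close>] by (simp add: mult.assoc)
  have 2: "D * q\<^sup>2 \<le> M * (r ^ 3 * q ^ 3)"
    using mult_right_mono[OF D(2), of "q\<^sup>2"] mult_left_mono[OF a \<open>0 \<le> M\<close>] by (simp add: mult_ac)
  have 3: "D * r\<^sup>2 \<le> M * (r ^ 3 * q ^ 3)"
  proof -
    have "D * r\<^sup>2 \<le> D * q\<^sup>2" using assms by (intro mult_left_mono power_mono) auto
    then show ?thesis using 2 by simp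
  qed
  have 4: "D * (r\<^sup>2 * q\<^sup>2) \<le> M * (r ^ 3 * q ^ 3)"
  proof (cases "1 \<le> r")
    case True
    have "D * (r\<^sup>2 * q\<^sup>2) \<le> M * (r ^ 3 * q ^ 3)"
      using assms True by (intro mult_mono power_increasing) auto
    then show ?thesis .
  next
    case False
    have "D * (r\<^sup>2 * q\<^sup>2) \<le> D * (1 * q\<^sup>2)"
      using assms False power_le_one[of r 2] by (intro mult_left_mono mult_right_mono) auto
    then show ?thesis using 2 by simp
  qed
  show ?thesis using 1 2 3 4 by (simp add: algebra_simps)
qed

section \<open>Mixed second differences and the second difference of \<open>L\<close>\<close>

context C3b begin

text \<open>By this symmetry each bound on the mixed difference also holds with \<open>s\<close> and
  \<open>t\<close> exchanged, so the one that suits the smaller increment can be chosen.\<close>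

lemma D2D2_commute: "D2 (\<lambda>y. D2 f y t) 0 s = D2 (\<lambda>y. D2 f y s) 0 t"
proof -
  have "f (- s - t) = f (- t - s)" by (rule arg_cong[where f=f]) simp
  then show ?thesis unfolding D2_def by (simp add: algebra_simps)
qed

text \<open>Every derivative of \<open>f\<close> that is spent buys one power of an increment: three
  give |t| s^2, two give t^2, none gives a constant.\<close>

lemma D2D2_bounds:
  "\<bar>D2 (\<lambda>y. D2 f y t) 0 s\<bar> \<le> 4 * M * \<bar>t\<bar> * s\<^sup>2"
  "\<bar>D2 (\<lambda>y. D2 f y t) 0 s\<bar> \<le> 8 * M * t\<^sup>2"
  "\<bar>D2 (\<lambda>y. D2 f y t) 0 s\<bar> \<le> 16 * M"
proof -
  have d0: "((\<lambda>y. D2 f y t) has_real_derivative D2 f1 y t) (at y)" for y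
    unfolding D2_def by (auto intro!: derivative_eq_intros DERIV_chain'[OF _ der0, THEN DERIV_cong])
  have d1: "((\<lambda>y. D2 f1 y t) has_real_derivative D2 f2 y t) (at y)" for y
    unfolding D2_def by (auto intro!: derivative_eq_intros DERIV_chain'[OF _ der1, THEN DERIV_cong])
  have b2: "\<bar>D2 f2 y t\<bar> \<le> 2 * M * \<bar>t\<bar>" for y
    using lip2[of y "y + t"] lip2[of y "y - t"] by (simp add: D2_def)
  have "\<bar>D2 f1 x t - D2 f1 y t\<bar> \<le> 2 * M * \<bar>t\<bar> * \<bar>x - y\<bar>" for x y
    by (rule Lipschitz_if_deriv_bounded[OF d1 b2])
  from D2_bound_Lipschitz[OF d0 this, of 0 s]
  show "\<bar>D2 (\<lambda>y. D2 f y t) 0 s\<bar> \<le> 4 * M * \<bar>t\<bar> * s\<^sup>2" by (simp add: mult.assoc)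
  show "\<bar>D2 (\<lambda>y. D2 f y t) 0 s\<bar> \<le> 8 * M * t\<^sup>2"
    using D2_bound_trivial[of "\<lambda>y. D2 f y t", OF D2f, of 0 s] by (simp add: mult.assoc)
  show "\<bar>D2 (\<lambda>y. D2 f y t) 0 s\<bar> \<le> 16 * M"
    using D2_bound_trivial[of "\<lambda>y. D2 f y t", OF D2_bound_trivial[of f, OF bd0]] by simp
qed

lemma D2D2_kap_bound: "\<bar>D2 (\<lambda>y. D2 f y s) 0 t\<bar> / (s\<^sup>2 * t\<^sup>2) \<le> 64 * M * (kap s * kap t)"
proof -
  define D where "D = \<bar>D2 (\<lambda>y. D2 f y s) 0 t\<bar>"
  define r where "r = sqrt \<bar>s\<bar>"
  define q where "q = sqrt \<bar>t\<bar>"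
  have rq: "0 \<le> r" "0 \<le> q" "0 \<le> D" "\<bar>s\<bar> = r\<^sup>2" "\<bar>t\<bar> = q\<^sup>2" by (simp_all add: r_def q_def D_def)
  have s2: "s\<^sup>2 = r ^ 4" "t\<^sup>2 = q ^ 4" using rq(4,5) power2_abs[of s] power2_abs[of t] by simp_all
  have D: "D \<le> 4 * M * q\<^sup>2 * r ^ 4" "D \<le> 4 * M * r\<^sup>2 * q ^ 4" "D \<le> 8 * M * r ^ 4" "D \<le> 8 * M * q ^ 4" "D \<le> 16 * M"
    using D2D2_bounds[where s=t and t=s] D2D2_bounds[where s=s and t=t] s2 rq(4,5) D2D2_commute[of s t]
    by (simp_all add: D_def)
  \<comment> \<open>The constants 4, 8 and 16 are coarsened to a common 16, so that
    \<open>min_bound_mono\<close> applies with 16 M; this is the origin of 64 = 4 * 16.\<close>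
  have mono: "4 * M * c \<le> 16 * M * c" "8 * M * c \<le> 16 * M * c" if "0 \<le> c" for c
    using that M_nonneg by (auto intro!: mult_right_mono)
  have main: "D * ((1 + r\<^sup>2) * (1 + q\<^sup>2)) \<le> 64 * M * (r ^ 3 * q ^ 3)"
  proof (cases "r \<le> q")
    case True
    have "D * ((1 + r\<^sup>2) * (1 + q\<^sup>2)) \<le> 4 * (16 * M) * (r ^ 3 * q ^ 3)"
      using D mono[of "r ^ 4"] mono[of "q\<^sup>2 * r ^ 4"] rq M_nonneg True
      by (intro min_bound_mono) (auto simp: mult.assoc)
    then show ?thesis by simp
  next
    case False
    have "D * ((1 + q\<^sup>2) * (1 + r\<^sup>2)) \<le> 4 * (16 * M) * (q ^ 3 * r ^ 3)"
      using D mono[of "q ^ 4"] mono[of "r\<^sup>2 * q ^ 4"] rq M_nonneg False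
      by (intro min_bound_mono) (auto simp: mult.assoc)
    then show ?thesis by (simp add: mult_ac)
  qed
  show ?thesis
  proof (cases "r = 0 \<or> q = 0")
    \<comment> \<open>One increment is 0, and both sides are 0 by division by zero.\<close>
    case True
    then show ?thesis using rq s2 M_nonneg by (auto simp: kap_def)
  next
    case False
    then have pos: "0 < r" "0 < q" using rq by auto
    have k: "kap s * kap t = 1 / (r * q * ((1 + r\<^sup>2) * (1 + q\<^sup>2)))"
      using pos unfolding kap_def r_def[symmetric] q_def[symmetric] rq(4,5) by (simp add: mult_ac)
    have "D / (r ^ 4 * q ^ 4) \<le> 64 * M * (1 / (r * q * ((1 + r\<^sup>2) * (1 + q\<^sup>2))))"
    proof -
      define e where "e = (1 + r\<^sup>2) * (1 + q\<^sup>2)"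
      have e: "0 < e" by (simp add: e_def add_pos_nonneg)
      have "D / (r ^ 4 * q ^ 4) = (D * e) / (r ^ 4 * q ^ 4 * e)" using e by simp
      also have "\<dots> \<le> (64 * M * (r ^ 3 * q ^ 3)) / (r ^ 4 * q ^ 4 * e)"
        using main e pos by (intro divide_right_mono) (auto simp: e_def)
      also have "\<dots> = 64 * M * (1 / (r * q * e))"
        using e pos by (simp add: field_simps power3_eq_cube power4_eq_xxxx)
      finally show ?thesis by (simp only: e_def)
    qed
    then show ?thesis by (simp only: k s2 D_def)
  qed
qed

lemma D2_L: "D2 L 0 t = 1 / (2 * pi) * (LINT s|lborel. D2 (\<lambda>y. D2 f y s) 0 t / s\<^sup>2)"
proof -
  have "D2 (\<lambda>y. D2 f y s) 0 t / s\<^sup>2 = 2 * (D2 f 0 s / s\<^sup>2) - D2 f t s / s\<^sup>2 - D2 f (- t) s / s\<^sup>2" for s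
    by (simp add: D2_def[of "\<lambda>y. D2 f y s"] diff_divide_distrib)
  then show ?thesis
    using int_D2f[of 0] int_D2f[of t] int_D2f[of "-t"]
    by (simp add: integral_eq_LamI D2_def[of L] right_diff_distrib del: times_divide_eq_right)
qed

text \<open>The majorant of the mixed difference is a product, so integrating out \<open>s\<close>
  leaves a constant times \<open>kap t\<close>.\<close>

lemma integrable_D2L: "integrable lborel (\<lambda>t. D2 L 0 t / t\<^sup>2)"
proof (rule integrable_D2_if_bound[OF measL])
  let ?C = "1 / (2 * pi) * (64 * M * (LINT s|lborel. kap s))"
  show "integrable lborel (\<lambda>t. ?C * kap t)" using integrable_kap by (rule integrable_mult_right)
  fix t
  have m: "(\<lambda>s. D2 (\<lambda>y. D2 f y s) 0 t / s\<^sup>2 / t\<^sup>2) \<in> borel_measurable lborel"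
    unfolding D2_def by measurable
  have b: "\<bar>D2 (\<lambda>y. D2 f y s) 0 t / s\<^sup>2\<bar> / t\<^sup>2 \<le> 64 * M * (kap s * kap t)" for s
    using D2D2_kap_bound[of s t] by (simp add: abs_divide)
  have ik: "integrable lborel (\<lambda>s. 64 * M * (kap s * kap t))" using integrable_kap by simp
  have ia: "integrable lborel (\<lambda>s. D2 (\<lambda>y. D2 f y s) 0 t / s\<^sup>2 / t\<^sup>2)"
    by (rule Bochner_Integration.integrable_bound[OF ik]) (rule m, use order_trans[OF b abs_ge_self] in \<open>auto simp: abs_divide\<close>)
  have "\<bar>D2 L 0 t / t\<^sup>2\<bar> = 1 / (2 * pi) * \<bar>LINT s|lborel. D2 (\<lambda>y. D2 f y s) 0 t / s\<^sup>2 / t\<^sup>2\<bar>"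
    by (simp add: D2_L abs_mult abs_divide del: divide_divide_eq_left)
  also have "\<dots> \<le> 1 / (2 * pi) * (LINT s|lborel. \<bar>D2 (\<lambda>y. D2 f y s) 0 t / s\<^sup>2 / t\<^sup>2\<bar>)"
    by (intro mult_left_mono integral_abs_bound) simp
  also have "\<dots> \<le> 1 / (2 * pi) * (LINT s|lborel. 64 * M * (kap s * kap t))"
    by (intro mult_left_mono integral_mono integrable_abs ia ik) (use b in \<open>simp_all add: abs_divide\<close>)
  also have "\<dots> = ?C * kap t" by simp
  finally show "\<bar>D2 L 0 t / t\<^sup>2\<bar> \<le> ?C * kap t" .
qed

end

text \<open>\<open>re_kernel d x\<close> and \<open>im_kernel d x\<close> are the real and imaginary part of $(x+id)^{-2}$, and \<open>poisson_dd d\<close> is the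
  second derivative of \<open>poisson d\<close>.\<close>

definition re_kernel :: "real \<Rightarrow> real \<Rightarrow> real" where "re_kernel d x = (cpoisson d x)\<^sup>2 - (poisson d x)\<^sup>2"
definition im_kernel :: "real \<Rightarrow> real \<Rightarrow> real" where "im_kernel d x = - 2 * cpoisson d x * poisson d x"
definition poisson_dd :: "real \<Rightarrow> real \<Rightarrow> real" where "poisson_dd d x = 2 * (3 * (cpoisson d x)\<^sup>2 * poisson d x - poisson d x ^ 3)"

lemma measurable_qrp [measurable]: "re_kernel d \<in> borel_measurable borel" "im_kernel d \<in> borel_measurable borel" "poisson_dd d \<in> borel_measurable borel"
  unfolding re_kernel_def im_kernel_def poisson_dd_def by measurable

text \<open>This is |1/z|^2 = 1/(x^2 + d^2); through it, quadratic expressions in the two kernels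
  are bounded by a single Poisson kernel.\<close>

lemma squares_cpoisson_poisson:
  assumes "0 < d"
  shows "(cpoisson d x)\<^sup>2 + (poisson d x)\<^sup>2 = poisson d x / d"
proof -
  define A where "A = x\<^sup>2 + d\<^sup>2"
  have "x\<^sup>2 / A\<^sup>2 + d\<^sup>2 / A\<^sup>2 = A / A\<^sup>2" by (simp add: A_def add_divide_distrib)
  also have "\<dots> = 1 / A" by (simp add: power2_eq_square)
  finally have "x\<^sup>2 / A\<^sup>2 + d\<^sup>2 / A\<^sup>2 = 1 / A" .
  then show ?thesis using assms by (simp add: cpoisson_def poisson_def A_def[symmetric] power_divide)
qed

text \<open>Real and imaginary part of (1/z)' = -1/z^2.\<close>

lemma
  assumes d: "0 < d"
  shows DERIV_cpoisson: "(cpoisson d has_real_derivative - re_kernel d x) (at x)"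
    and DERIV_poisson: "(poisson d has_real_derivative im_kernel d x) (at x)"
proof -
  define A where "A = x\<^sup>2 + d\<^sup>2"
  have A: "A \<noteq> 0" using sum_squares_pos[OF d, of x] unfolding A_def by linarith
  have "((\<lambda>x. x / (x\<^sup>2 + d\<^sup>2)) has_real_derivative (1 * A - x * (2 * x)) / (A * A)) (at x)"
    unfolding A_def using A d by (auto intro!: derivative_eq_intros simp: A_def)
  moreover have "(1 * A - x * (2 * x)) / (A * A) = - re_kernel d x"
    unfolding re_kernel_def cpoisson_def poisson_def A_def[symmetric] using A
    by (simp add: power_divide power2_eq_square diff_divide_distrib[symmetric] minus_divide_left)
       (simp add: A_def power2_eq_square)
  ultimately show "(cpoisson d has_real_derivative - re_kernel d x) (at x)"
    unfolding cpoisson_def[abs_def] by simp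
  have "((\<lambda>x. d / (x\<^sup>2 + d\<^sup>2)) has_real_derivative - (d * (2 * x)) / (A * A)) (at x)"
    unfolding A_def using A d by (auto intro!: derivative_eq_intros simp: A_def)
  moreover have "- (d * (2 * x)) / (A * A) = im_kernel d x"
    unfolding im_kernel_def cpoisson_def poisson_def A_def[symmetric] by simp
  ultimately show "(poisson d has_real_derivative im_kernel d x) (at x)"
    unfolding poisson_def[abs_def] by simp
qed

text \<open>In complex form the derivative of Im z^(-2) is -2 Im z^(-3).\<close>

lemma DERIV_im_kernel:
  assumes d: "0 < d"
  shows "(im_kernel d has_real_derivative poisson_dd d x) (at x)"
proof -
  have "(im_kernel d has_real_derivative - 2 * (- re_kernel d x) * poisson d x + - 2 * cpoisson d x * im_kernel d x) (at x)"
    unfolding im_kernel_def[of d, abs_def]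
    by (rule derivative_eq_intros refl DERIV_cpoisson[OF d] DERIV_poisson[OF d])+ (simp add: im_kernel_def)
  also have "- 2 * (- re_kernel d x) * poisson d x + - 2 * cpoisson d x * im_kernel d x = poisson_dd d x"
    by (simp add: re_kernel_def im_kernel_def poisson_dd_def algebra_simps power2_eq_square power3_eq_cube)
  finally show ?thesis .
qed

lemma
  assumes d: "0 < d"
  shows tendsto_cpoisson_infinity: "(cpoisson d \<longlongrightarrow> 0) at_top" "(cpoisson d \<longlongrightarrow> 0) at_bot"
    and tendsto_poisson_infinity: "(poisson d \<longlongrightarrow> 0) at_top" "(poisson d \<longlongrightarrow> 0) at_bot"
  unfolding cpoisson_def[abs_def] poisson_def[abs_def] using d by real_asymp+

lemma tendsto_im_kernel_infinity:
  assumes d: "0 < d"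
  shows "(im_kernel d \<longlongrightarrow> 0) at_top" "(im_kernel d \<longlongrightarrow> 0) at_bot"
  unfolding im_kernel_def[abs_def]
  using tendsto_mult[OF tendsto_mult[OF tendsto_const[of "-2"] tendsto_cpoisson_infinity(1)[OF d]] tendsto_poisson_infinity(1)[OF d]]
    tendsto_mult[OF tendsto_mult[OF tendsto_const[of "-2"] tendsto_cpoisson_infinity(2)[OF d]] tendsto_poisson_infinity(2)[OF d]] by simp_all

lemma cont_kernels:
  assumes d: "0 < d"
  shows "continuous_on S (cpoisson d)" "continuous_on S (poisson d)" "continuous_on S (re_kernel d)" "continuous_on S (im_kernel d)" "continuous_on S (poisson_dd d)"
proof -
  show k: "continuous_on S (cpoisson d)" "continuous_on S (poisson d)"
    using DERIV_cpoisson[OF d] DERIV_poisson[OF d] by (meson DERIV_continuous continuous_at_imp_continuous_on)+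
  show "continuous_on S (re_kernel d)" "continuous_on S (im_kernel d)" "continuous_on S (poisson_dd d)"
    unfolding re_kernel_def[abs_def] im_kernel_def[abs_def] poisson_dd_def[abs_def] using k by (auto intro!: continuous_intros)
qed

lemma
  assumes d: "0 < d"
  shows abs_re_kernel: "\<bar>re_kernel d x\<bar> \<le> poisson d x / d" and abs_im_kernel: "\<bar>im_kernel d x\<bar> \<le> poisson d x / d"
    and abs_poisson_dd: "\<bar>poisson_dd d x\<bar> \<le> 6 * (poisson d x)\<^sup>2 / d"
proof -
  show "\<bar>re_kernel d x\<bar> \<le> poisson d x / d"
    unfolding re_kernel_def squares_cpoisson_poisson[OF d, symmetric] by (auto simp: abs_le_iff)
  have "2 * \<bar>cpoisson d x\<bar> * \<bar>poisson d x\<bar> \<le> (cpoisson d x)\<^sup>2 + (poisson d x)\<^sup>2"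
    using sum_squares_bound[of "\<bar>cpoisson d x\<bar>" "\<bar>poisson d x\<bar>"] by simp
  then show "\<bar>im_kernel d x\<bar> \<le> poisson d x / d"
    unfolding squares_cpoisson_poisson[OF d] im_kernel_def by (simp add: abs_mult)
  have "poisson_dd d x = poisson d x * (2 * (3 * (cpoisson d x)\<^sup>2 - (poisson d x)\<^sup>2))"
    by (simp add: poisson_dd_def power2_eq_square power3_eq_cube algebra_simps)
  also have "\<bar>\<dots>\<bar> \<le> poisson d x * (6 * ((cpoisson d x)\<^sup>2 + (poisson d x)\<^sup>2))"
    unfolding abs_mult[of "poisson d x"] using poisson_nonneg[OF d] by (auto intro!: mult_mono simp: abs_le_iff)
  finally show "\<bar>poisson_dd d x\<bar> \<le> 6 * (poisson d x)\<^sup>2 / d"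
    unfolding squares_cpoisson_poisson[OF d] by (simp add: power2_eq_square mult_ac)
qed

lemma
  assumes d: "0 < d"
  shows integrable_re_kernel: "integrable lborel (re_kernel d)" and integrable_im_kernel: "integrable lborel (im_kernel d)"
    and integrable_poisson_dd: "integrable lborel (poisson_dd d)"
proof -
  have i: "integrable lborel (\<lambda>x. poisson d x / d)" using integrable_poisson[OF d] by simp
  show "integrable lborel (re_kernel d)" "integrable lborel (im_kernel d)"
    by (rule Bochner_Integration.integrable_bound[OF i];
        use order_trans[OF abs_re_kernel[OF d] abs_ge_self] order_trans[OF abs_im_kernel[OF d] abs_ge_self] in simp)+
  have b: "\<bar>poisson d x\<bar> \<le> 1 / d" for x
    using d sum_squares_pos[OF d, of x] by (simp add: poisson_def divide_simps power2_eq_square)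
  have "integrable lborel (\<lambda>x. 6 / d * (poisson d x * poisson d x))"
    by (intro integrable_mult_right integrable_mult_bounded[OF integrable_poisson[OF d] _ b]) measurable
  then show "integrable lborel (poisson_dd d)"
    by (rule Bochner_Integration.integrable_bound)
       (use order_trans[OF abs_poisson_dd[OF d] abs_ge_self] in \<open>simp_all add: power2_eq_square\<close>)
qed

text \<open>Up to sign, each kernel is the derivative of a function vanishing at both ends. The zero
  means remove most terms when \<Lambda> is applied to \<open>re_kernel\<close>, and allow the
  passage to second differences in \<open>integral_even_D2\<close>.\<close>

lemma
  assumes d: "0 < d"
  shows integral_re_kernel: "(LINT x|lborel. re_kernel d x) = 0" and integral_im_kernel: "(LINT x|lborel. im_kernel d x) = 0"
    and integral_poisson_dd: "(LINT x|lborel. poisson_dd d x) = 0"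
proof -
  have "(LINT x|lborel. - re_kernel d x) = 0 - 0"
    by (rule integral_FTC_UNIV[of "cpoisson d"])
       (use DERIV_cpoisson[OF d] cont_kernels[OF d] integrable_re_kernel[OF d] tendsto_cpoisson_infinity[OF d] in
        \<open>auto simp flip: has_real_derivative_iff_has_vector_derivative intro!: continuous_intros\<close>)
  then show "(LINT x|lborel. re_kernel d x) = 0" by simp
  have "(LINT x|lborel. im_kernel d x) = 0 - 0"
    by (rule integral_FTC_UNIV[of "poisson d"])
       (use DERIV_poisson[OF d] cont_kernels[OF d] integrable_im_kernel[OF d] tendsto_poisson_infinity[OF d] in
        \<open>auto simp flip: has_real_derivative_iff_has_vector_derivative\<close>)
  then show "(LINT x|lborel. im_kernel d x) = 0" by simp
  have "(LINT x|lborel. poisson_dd d x) = 0 - 0"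
    by (rule integral_FTC_UNIV[of "im_kernel d"])
       (use DERIV_im_kernel[OF d] cont_kernels[OF d] integrable_poisson_dd[OF d] tendsto_im_kernel_infinity[OF d] in
        \<open>auto simp flip: has_real_derivative_iff_has_vector_derivative\<close>)
  then show "(LINT x|lborel. poisson_dd d x) = 0" by simp
qed

section \<open>The operator applied to Re (x + i d)^(-2), in closed form\<close>

lemma Complex_kernel:
  assumes d: "0 < d"
  shows "1 / Complex x d = Complex (cpoisson d x) (- poisson d x)"
  using sum_squares_pos[OF d, of x] by (simp add: complex_eq_iff Re_divide Im_divide cpoisson_def poisson_def)

text \<open>Partial fractions in \<open>t\<close>: the numerator vanishes to second order at t = 0,
  so only the poles at t = z and t = -z remain.\<close>

lemma D2_inverse_square:
  fixes z t :: complex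
  assumes "z \<noteq> 0" "z + t \<noteq> 0" "z - t \<noteq> 0" "t \<noteq> 0"
  shows "(2 * (1 / z)\<^sup>2 - (1 / (z + t))\<^sup>2 - (1 / (z - t))\<^sup>2) / t\<^sup>2
    = - 2 * (1 / z) ^ 3 * (1 / (z + t) + 1 / (z - t)) - (1 / z)\<^sup>2 * ((1 / (z + t))\<^sup>2 + (1 / (z - t))\<^sup>2)"
  using assms by (simp add: divide_simps) (simp add: algebra_simps power2_eq_square power3_eq_cube)

text \<open>Each summand decays like 1/t, but their sum like 1/t^2; this cancellation is what makes
  the closed form integrable in \<open>t\<close>.\<close>

lemma inverse_sum:
  fixes z t :: complex
  assumes "z + t \<noteq> 0" "z - t \<noteq> 0"
  shows "1 / (z + t) + 1 / (z - t) = 2 * z * (1 / (z + t) * (1 / (z - t)))"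
  using assms by (simp add: divide_simps)

lemma cmod_kernel:
  assumes d: "0 < d"
  shows "(cmod (1 / Complex x d))\<^sup>2 = poisson d x / d"
  unfolding Complex_kernel[OF d] cmod_power2 using squares_cpoisson_poisson[OF d, of x] by simp

lemma cmod_kernel_product:
  assumes d: "0 < d"
  shows "2 * cmod (1 / Complex x d * (1 / Complex y d)) \<le> (poisson d x + poisson d y) / d"
  using sum_squares_bound[of "cmod (1 / Complex x d)" "cmod (1 / Complex y d)"]
  unfolding cmod_kernel[OF d] norm_mult by (simp add: add_divide_distrib)

lemma Complex_shift: "Complex (x + t) d = Complex x d + of_real t" "Complex (x - t) d = Complex x d - of_real t"
  by (simp_all add: complex_eq_iff)

lemma Complex_neq_0: "0 < d \<Longrightarrow> Complex x d \<noteq> 0"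
  by (simp add: complex_eq_iff)

text \<open>Neither translate of \<open>cpoisson d\<close> is integrable, but opposite shifts cancel
  at infinity. The factor sqrt (x^2 + d^2) is |z| from \<open>inverse_sum\<close>.\<close>

lemma cpoisson_sum_bound:
  assumes d: "0 < d"
  shows "\<bar>cpoisson d (x + t) + cpoisson d (x - t)\<bar> \<le> sqrt (x\<^sup>2 + d\<^sup>2) / d * (poisson d (x + t) + poisson d (x - t))"
proof -
  let ?z = "Complex x d" and ?a = "1 / Complex (x + t) d" and ?b = "1 / Complex (x - t) d"
  have "?a + ?b = 2 * ?z * (?a * ?b)"
    using Complex_neq_0[OF d] unfolding Complex_shift by (intro inverse_sum) (simp_all flip: Complex_shift)
  moreover have "cpoisson d (x + t) + cpoisson d (x - t) = Re (?a + ?b)"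
    by (simp add: Complex_kernel[OF d])
  ultimately have "\<bar>cpoisson d (x + t) + cpoisson d (x - t)\<bar> \<le> cmod (2 * ?z * (?a * ?b))"
    using abs_Re_le_cmod by metis
  also have "\<dots> = sqrt (x\<^sup>2 + d\<^sup>2) * (2 * cmod (?a * ?b))"
  proof -
    have "cmod ?z = sqrt (x\<^sup>2 + d\<^sup>2)" by (simp add: cmod_def)
    then show ?thesis by (simp add: norm_mult norm_divide)
  qed
  also have "\<dots> \<le> sqrt (x\<^sup>2 + d\<^sup>2) * ((poisson d (x + t) + poisson d (x - t)) / d)"
    by (intro mult_left_mono cmod_kernel_product[OF d]) simp
  finally show ?thesis by simp
qed

lemma
  assumes d: "0 < d"
  shows integrable_cpoisson_sum: "integrable lborel (\<lambda>t. cpoisson d (x + t) + cpoisson d (x - t))"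
    and integral_cpoisson_sum: "(LINT t|lborel. cpoisson d (x + t) + cpoisson d (x - t)) = 0"
proof -
  have i: "integrable lborel (\<lambda>t. poisson d (x + t))" "integrable lborel (\<lambda>t. poisson d (x - t))"
    using integrable_lborel_shift[of "poisson d" x] integrable_poisson[OF d] lborel_integrable_real_affine[of "poisson d" "-1" x]
    by (simp_all add: add.commute)
  show int: "integrable lborel (\<lambda>t. cpoisson d (x + t) + cpoisson d (x - t))"
  proof (rule Bochner_Integration.integrable_bound)
    show "integrable lborel (\<lambda>t. sqrt (x\<^sup>2 + d\<^sup>2) / d * (poisson d (x + t) + poisson d (x - t)))"
      using i by (intro integrable_mult_right Bochner_Integration.integrable_add)
    show "(\<lambda>t. cpoisson d (x + t) + cpoisson d (x - t)) \<in> borel_measurable lborel" by measurable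
    show "AE t in lborel. norm (cpoisson d (x + t) + cpoisson d (x - t)) \<le> norm (sqrt (x\<^sup>2 + d\<^sup>2) / d * (poisson d (x + t) + poisson d (x - t)))"
      using order_trans[OF cpoisson_sum_bound[OF d] abs_ge_self] by (intro AE_I2) simp
  qed
  \<comment> \<open>An antiderivative: half the logarithm of |z + t|^2 / |z - t|^2, a ratio that
    tends to 1 at both ends.\<close>
  define F where "F t = (ln ((x + t)\<^sup>2 + d\<^sup>2) - ln ((x - t)\<^sup>2 + d\<^sup>2)) / 2" for t
  have "(LINT t|lborel. cpoisson d (x + t) + cpoisson d (x - t)) = 0 - 0"
  proof (rule integral_FTC_UNIV[of F])
    show "(F has_vector_derivative cpoisson d (x + t) + cpoisson d (x - t)) (at t)" for t
    proof -
      have "((\<lambda>t. ln ((x + t)\<^sup>2 + d\<^sup>2)) has_real_derivative 2 * cpoisson d (x + t)) (at t)"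
        "((\<lambda>t. ln ((x - t)\<^sup>2 + d\<^sup>2)) has_real_derivative - 2 * cpoisson d (x - t)) (at t)"
        using sum_squares_pos[OF d, of "x + t"] sum_squares_pos[OF d, of "x - t"]
        unfolding cpoisson_def by (auto intro!: derivative_eq_intros)
      from DERIV_cdivide[OF DERIV_diff[OF this], of 2] show ?thesis
        by (simp add: F_def[abs_def] add_divide_distrib flip: has_real_derivative_iff_has_vector_derivative)
    qed
    show "continuous_on UNIV (\<lambda>t. cpoisson d (x + t) + cpoisson d (x - t))"
      by (intro continuous_intros continuous_on_compose2[OF cont_kernels(1)[OF d, of UNIV]]) auto
    show "(F \<longlongrightarrow> 0) at_top" "(F \<longlongrightarrow> 0) at_bot"
      unfolding F_def using d by real_asymp+
  qed (rule int)
  then show "(LINT t|lborel. cpoisson d (x + t) + cpoisson d (x - t)) = 0" by simp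
qed

lemma re_kernel_eq_Re: "0 < d \<Longrightarrow> re_kernel d x = Re ((1 / Complex x d)\<^sup>2)"
  by (simp add: Complex_kernel re_kernel_def power2_eq_square)

lemma D2_re_kernel_complex:
  assumes d: "0 < d"
  shows "D2 (re_kernel d) x t / t\<^sup>2 = Re ((2 * (1 / Complex x d)\<^sup>2 - (1 / (Complex x d + of_real t))\<^sup>2
    - (1 / (Complex x d - of_real t))\<^sup>2) / (of_real t)\<^sup>2)"
proof -
  have "Re (u / (of_real t)\<^sup>2) = Re u / t\<^sup>2" for u
    unfolding of_real_power[symmetric] by (rule Re_divide_of_real)
  then show ?thesis
    unfolding D2_def re_kernel_eq_Re[OF d] Complex_shift by simp
qed

text \<open>Real part of \<open>D2_inverse_square\<close>, arranged as factors in \<open>x\<close>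
  times symmetric sums over the two shifts, so that the integral over \<open>t\<close> can be taken
  term by term.\<close>

lemma D2_re_kernel:
  assumes d: "0 < d" and t: "t \<noteq> 0"
  shows "D2 (re_kernel d) x t / t\<^sup>2 =
     - 2 * (((cpoisson d x) ^ 3 - 3 * cpoisson d x * (poisson d x)\<^sup>2) * (cpoisson d (x + t) + cpoisson d (x - t)))
     + poisson_dd d x * (poisson d (x + t) + poisson d (x - t))
     - (re_kernel d x * (re_kernel d (x + t) + re_kernel d (x - t)) - im_kernel d x * (im_kernel d (x + t) + im_kernel d (x - t)))"
proof -
  have nz: "Complex x d + of_real t \<noteq> 0" "Complex x d - of_real t \<noteq> 0" "of_real t \<noteq> (0 :: complex)"
    using Complex_neq_0[OF d] t by (simp_all flip: Complex_shift)
  show ?thesis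
    unfolding D2_re_kernel_complex[OF d] D2_inverse_square[OF Complex_neq_0[OF d] nz]
    unfolding Complex_shift[symmetric] Complex_kernel[OF d]
    by (simp add: re_kernel_def im_kernel_def poisson_dd_def power2_eq_square power3_eq_cube) (simp add: algebra_simps)
qed

text \<open>A product majorant for Fubini. \<open>inverse_sum\<close> cancels one of the three
  factors 1/z, and |ab| \<le> (|a|^2 + |b|^2)/2 turns the rest into Poisson kernels; 3 = 2 + 1
  counts the mixed and the pure squares.\<close>

lemma D2_re_kernel_bound:
  assumes d: "0 < d"
  shows "\<bar>D2 (re_kernel d) x t / t\<^sup>2\<bar> \<le> 3 / d\<^sup>2 * (poisson d x * poisson d (x + t) + poisson d x * poisson d (x - t))"
proof (cases "t = 0")
  case True
  then show ?thesis using poisson_nonneg[OF d] by simp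
next
  case False
  let ?z = "Complex x d" and ?a = "1 / Complex (x + t) d" and ?b = "1 / Complex (x - t) d"
  have nz: "Complex x d + of_real t \<noteq> 0" "Complex x d - of_real t \<noteq> 0" "of_real t \<noteq> (0 :: complex)"
    using Complex_neq_0[OF d] False by (simp_all flip: Complex_shift)
  have "- 2 * (1 / ?z) ^ 3 * (?a + ?b) - (1 / ?z)\<^sup>2 * (?a\<^sup>2 + ?b\<^sup>2)
    = - ((1 / ?z)\<^sup>2 * (2 * (2 * (?a * ?b)) + (?a\<^sup>2 + ?b\<^sup>2)))"
    unfolding Complex_shift inverse_sum[OF nz(1,2)] using Complex_neq_0[OF d, of x]
    by (simp add: power2_eq_square power3_eq_cube algebra_simps)
  then have "\<bar>D2 (re_kernel d) x t / t\<^sup>2\<bar> \<le> cmod (- ((1 / ?z)\<^sup>2 * (2 * (2 * (?a * ?b)) + (?a\<^sup>2 + ?b\<^sup>2))))"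
    unfolding D2_re_kernel_complex[OF d] D2_inverse_square[OF Complex_neq_0[OF d] nz]
    unfolding Complex_shift[symmetric] by (metis abs_Re_le_cmod)
  also have "\<dots> = (cmod (1 / ?z))\<^sup>2 * cmod (2 * (2 * (?a * ?b)) + (?a\<^sup>2 + ?b\<^sup>2))"
    by (simp only: norm_minus_cancel norm_mult norm_power)
  also have "\<dots> \<le> poisson d x / d * (2 * ((poisson d (x + t) + poisson d (x - t)) / d) + (poisson d (x + t) / d + poisson d (x - t) / d))"
    unfolding cmod_kernel[OF d]
  proof (rule mult_left_mono)
    have "cmod (2 * (2 * (?a * ?b)) + (?a\<^sup>2 + ?b\<^sup>2)) \<le> cmod (2 * (2 * (?a * ?b))) + (cmod (?a\<^sup>2) + cmod (?b\<^sup>2))"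
      by (intro order_trans[OF norm_triangle_ineq] add_left_mono norm_triangle_ineq)
    also have "\<dots> = 2 * (2 * cmod (?a * ?b)) + ((cmod ?a)\<^sup>2 + (cmod ?b)\<^sup>2)"
      by (simp only: norm_mult[of 2] norm_power) simp
    also have "\<dots> \<le> 2 * ((poisson d (x + t) + poisson d (x - t)) / d) + (poisson d (x + t) / d + poisson d (x - t) / d)"
      unfolding cmod_kernel[OF d] by (intro add_right_mono mult_left_mono cmod_kernel_product[OF d]) simp
    finally show "cmod (2 * (2 * (?a * ?b)) + (?a\<^sup>2 + ?b\<^sup>2))
      \<le> 2 * ((poisson d (x + t) + poisson d (x - t)) / d) + (poisson d (x + t) / d + poisson d (x - t) / d)" .
  qed (use poisson_nonneg[OF d] d in simp)
  also have "\<dots> = 3 / d\<^sup>2 * (poisson d x * poisson d (x + t) + poisson d x * poisson d (x - t))"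
    using d by (simp add: field_simps power2_eq_square)
  finally show ?thesis .
qed

lemma lborel_shift_t:
  fixes u :: "real \<Rightarrow> real"
  assumes "integrable lborel u"
  shows "integrable lborel (\<lambda>t. u (x + t) + u (x - t))" "(LINT t|lborel. u (x + t) + u (x - t)) = 2 * (LINT t|lborel. u t)"
  using assms lborel_integrable_real_affine[OF assms, of 1 x] lborel_integrable_real_affine[OF assms, of "-1" x]
    lborel_integral_real_affine[of 1 u x] lborel_integral_real_affine[of "-1" u x] by simp_all

text \<open>Of the terms in \<open>D2_re_kernel\<close> only the Poisson one has nonzero integral,
  two translates of mass pi each. The result says that \<Lambda> maps \<open>re_kernel d\<close> to
  \<open>poisson_dd d\<close>.\<close>

lemma integral_D2_re_kernel:
  assumes d: "0 < d"
  shows "(LINT t|lborel. D2 (re_kernel d) x t / t\<^sup>2) = 2 * pi * poisson_dd d x"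
proof -
  let ?c = "(cpoisson d x) ^ 3 - 3 * cpoisson d x * (poisson d x)\<^sup>2"
  note sh = lborel_shift_t[of _ x]
  note int = sh(1)[OF integrable_poisson[OF d]] sh(1)[OF integrable_re_kernel[OF d]] sh(1)[OF integrable_im_kernel[OF d]] integrable_cpoisson_sum[OF d, of x]
  have "(LINT t|lborel. D2 (re_kernel d) x t / t\<^sup>2) = (LINT t|lborel. - 2 * (?c * (cpoisson d (x + t) + cpoisson d (x - t)))
     + poisson_dd d x * (poisson d (x + t) + poisson d (x - t))
     - (re_kernel d x * (re_kernel d (x + t) + re_kernel d (x - t)) - im_kernel d x * (im_kernel d (x + t) + im_kernel d (x - t))))"
  proof (rule integral_cong_AE)
    show "AE t in lborel. D2 (re_kernel d) x t / t\<^sup>2 = - 2 * (?c * (cpoisson d (x + t) + cpoisson d (x - t)))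
     + poisson_dd d x * (poisson d (x + t) + poisson d (x - t))
     - (re_kernel d x * (re_kernel d (x + t) + re_kernel d (x - t)) - im_kernel d x * (im_kernel d (x + t) + im_kernel d (x - t)))"
      using AE_lborel_singleton[of 0] by eventually_elim (rule D2_re_kernel[OF d])
  qed measurable
  also have "\<dots> = - 2 * (?c * (LINT t|lborel. cpoisson d (x + t) + cpoisson d (x - t)))
     + poisson_dd d x * (LINT t|lborel. poisson d (x + t) + poisson d (x - t))
     - (re_kernel d x * (LINT t|lborel. re_kernel d (x + t) + re_kernel d (x - t)) - im_kernel d x * (LINT t|lborel. im_kernel d (x + t) + im_kernel d (x - t)))"
    using int
    by (simp only: integral_mult_right_zero Bochner_Integration.integral_diff Bochner_Integration.integral_add
        Bochner_Integration.integrable_diff Bochner_Integration.integrable_add integrable_mult_right)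
  also have "\<dots> = 2 * pi * poisson_dd d x"
    unfolding integral_cpoisson_sum[OF d] sh(2)[OF integrable_poisson[OF d]] sh(2)[OF integrable_re_kernel[OF d]] sh(2)[OF integrable_im_kernel[OF d]]
      integral_re_kernel[OF d] integral_im_kernel[OF d] integral_poisson[OF d] by simp
  finally show ?thesis .
qed

text \<open>Self-adjointness of \<Lambda> at fixed increment, by translation invariance. One
  function is integrable and the other merely bounded, which suits a kernel tested against
  \<open>f\<close>.\<close>

lemma integral_mult_D2_commute:
  assumes u: "integrable lborel u" and v: "v \<in> borel_measurable borel" "\<And>x. \<bar>v x\<bar> \<le> B"
  shows "(LINT x|lborel. u x * D2 v x t) = (LINT x|lborel. v x * D2 u x t)"
proof -
  have iu: "integrable lborel (\<lambda>x. u (x + c))" for c using u integrable_lborel_shift[of u c] by simp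
  have vm: "(\<lambda>x. v (x + c)) \<in> borel_measurable borel" for c using v(1) by measurable
  have i: "integrable lborel (\<lambda>x. u x * v (x + c))" "integrable lborel (\<lambda>x. v x * u (x + c))" for c
    using integrable_mult_bounded[OF u vm v(2)] integrable_mult_bounded[OF iu v] by (simp_all add: mult.commute)
  have s: "(LINT x|lborel. u x * v (x + c)) = (LINT x|lborel. v x * u (x + (- c)))" for c
    using integral_lborel_shift[of "\<lambda>x. u x * v (x + c)" "- c"] by (simp add: mult.commute)
  have "(LINT x|lborel. u x * D2 v x t) = 2 * (LINT x|lborel. u x * v (x + 0)) - (LINT x|lborel. u x * v (x + t)) - (LINT x|lborel. u x * v (x + (- t)))"
    using i(1)[of 0] i(1)[of t] i(1)[of "-t"] by (simp add: D2_def right_diff_distrib mult.left_commute[of _ 2])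
  also have "\<dots> = 2 * (LINT x|lborel. v x * u (x + 0)) - (LINT x|lborel. v x * u (x + (- t))) - (LINT x|lborel. v x * u (x + t))"
    unfolding s by simp
  also have "\<dots> = (LINT x|lborel. v x * D2 u x t)"
    using i(2)[of 0] i(2)[of t] i(2)[of "-t"] by (simp add: D2_def right_diff_distrib mult.left_commute[of _ 2])
  finally show ?thesis .
qed

text \<open>Zero mean removes the term with \<open>v 0\<close>, and evenness makes the two remaining
  terms equal. Testing against \<open>u\<close> therefore sees \<open>v\<close> only through its
  second difference at 0.\<close>

lemma integral_even_D2:
  fixes u v :: "real \<Rightarrow> real"
  assumes u: "integrable lborel u" "(LINT x|lborel. u x) = 0" "\<And>x. u (- x) = u x"
    and v: "v \<in> borel_measurable borel" "\<And>x. \<bar>v x\<bar> \<le> B"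
  shows "(LINT x|lborel. u x * v x) = - (LINT x|lborel. u x * D2 v 0 x) / 2"
proof -
  have i: "integrable lborel (\<lambda>x. u x * v x)" by (rule integrable_mult_bounded[OF u(1) v])
  have i': "integrable lborel (\<lambda>x. u x * v (- x))" "(LINT x|lborel. u x * v (- x)) = (LINT x|lborel. u x * v x)"
    using i integrable_lborel_reflect[of "\<lambda>x. u x * v x"] integral_lborel_reflect[of "\<lambda>x. u x * v x"] u(3) by simp_all
  have "(LINT x|lborel. u x * D2 v 0 x) = (LINT x|lborel. 2 * v 0 * u x - u x * v x - u x * v (- x))"
    by (simp add: D2_def right_diff_distrib mult_ac)
  also have "\<dots> = - 2 * (LINT x|lborel. u x * v x)"
    using i i' u(1,2) by simp
  finally show ?thesis by simp
qed

section \<open>Transfer of the operator from \<open>f\<close> to the kernel\<close>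

context C3b begin

text \<open>\<Lambda> is moved from \<open>f\<close> to the kernel, where it is known in closed
  form. The two interchanges need different majorants: the first uses the smoothness of
  \<open>f\<close>, the second that of the kernel.\<close>

lemma integral_re_kernel_L:
  assumes d: "0 < d"
  shows "(LINT x|lborel. re_kernel d x * L x) = (LINT x|lborel. poisson_dd d x * f x)"
proof -
  have i1: "integrable (lborel \<Otimes>\<^sub>M lborel) (\<lambda>(x, t). re_kernel d x * (D2 f x t / t\<^sup>2))"
  proof (rule Bochner_Integration.integrable_bound)
    show "integrable (lborel \<Otimes>\<^sub>M lborel) (\<lambda>(x, t). 6 * M / d * (poisson d x * weight t))"
      using integrable_product[OF integrable_poisson[OF d] integrable_weight] unfolding split_beta' by (rule integrable_mult_right)
    show "(\<lambda>(x, t). re_kernel d x * (D2 f x t / t\<^sup>2)) \<in> borel_measurable (lborel \<Otimes>\<^sub>M lborel)"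
      unfolding case_prod_beta by measurable
    have b: "\<bar>re_kernel d x * (D2 f x t / t\<^sup>2)\<bar> \<le> 6 * M / d * (poisson d x * weight t)" for x t
    proof -
      have "\<bar>re_kernel d x * (D2 f x t / t\<^sup>2)\<bar> \<le> poisson d x / d * (6 * M * weight t)"
        unfolding abs_mult[of "re_kernel d x"] using poisson_nonneg[OF d] d by (intro mult_mono abs_re_kernel[OF d] D2f_weight) auto
      then show ?thesis by (simp add: mult_ac)
    qed
    show "AE p in lborel \<Otimes>\<^sub>M lborel. norm (case p of (x, t) \<Rightarrow> re_kernel d x * (D2 f x t / t\<^sup>2))
        \<le> norm (case p of (x, t) \<Rightarrow> 6 * M / d * (poisson d x * weight t))"
      using order_trans[OF b abs_ge_self] by (intro AE_I2) auto
  qed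
  have i2: "integrable (lborel \<Otimes>\<^sub>M lborel) (\<lambda>(x, t). f x * (D2 (re_kernel d) x t / t\<^sup>2))"
  proof (rule Bochner_Integration.integrable_bound)
    show "integrable (lborel \<Otimes>\<^sub>M lborel) (\<lambda>(x, t). M * (3 / d\<^sup>2) * (poisson d x * poisson d (x + t) + poisson d x * poisson d (x - t)))"
      using integrable_product_shear[OF integrable_poisson[OF d] integrable_poisson[OF d], of 1, simplified]
        integrable_product_shear[OF integrable_poisson[OF d] integrable_poisson[OF d], of "-1", simplified]
      unfolding split_beta' by (intro integrable_mult_right Bochner_Integration.integrable_add)
    show "(\<lambda>(x, t). f x * (D2 (re_kernel d) x t / t\<^sup>2)) \<in> borel_measurable (lborel \<Otimes>\<^sub>M lborel)"
      unfolding case_prod_beta by measurable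
    have b: "\<bar>f x * (D2 (re_kernel d) x t / t\<^sup>2)\<bar> \<le> M * (3 / d\<^sup>2) * (poisson d x * poisson d (x + t) + poisson d x * poisson d (x - t))" for x t
      unfolding abs_mult[of "f x"] mult.assoc using M_nonneg by (intro mult_mono bd0 D2_re_kernel_bound[OF d]) auto
    show "AE p in lborel \<Otimes>\<^sub>M lborel. norm (case p of (x, t) \<Rightarrow> f x * (D2 (re_kernel d) x t / t\<^sup>2))
        \<le> norm (case p of (x, t) \<Rightarrow> M * (3 / d\<^sup>2) * (poisson d x * poisson d (x + t) + poisson d x * poisson d (x - t)))"
      using order_trans[OF b abs_ge_self] by (intro AE_I2) auto
  qed
  have "2 * pi * (LINT x|lborel. re_kernel d x * L x) = (LINT x|lborel. 2 * pi * (re_kernel d x * L x))"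
    by (rule integral_mult_right_zero[symmetric])
  also have "\<dots> = (LINT x|lborel. LINT t|lborel. re_kernel d x * (D2 f x t / t\<^sup>2))"
    unfolding integral_eq_LamI integral_mult_right_zero[of "lborel :: real measure" "re_kernel d _"]
    by (intro Bochner_Integration.integral_cong) simp_all
  also have "\<dots> = (LINT t|lborel. LINT x|lborel. re_kernel d x * (D2 f x t / t\<^sup>2))"
    by (rule lborel_pair.Fubini_integral[OF i1, symmetric])
  also have "\<dots> = (LINT t|lborel. LINT x|lborel. f x * (D2 (re_kernel d) x t / t\<^sup>2))"
    using integral_mult_D2_commute[OF integrable_re_kernel[OF d] meas(1) bd0] by simp
  also have "\<dots> = (LINT x|lborel. LINT t|lborel. f x * (D2 (re_kernel d) x t / t\<^sup>2))"
    by (rule lborel_pair.Fubini_integral[OF i2])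
  also have "\<dots> = (LINT x|lborel. 2 * pi * (poisson_dd d x * f x))"
    unfolding integral_mult_right_zero[of "lborel :: real measure" "f _"] integral_D2_re_kernel[OF d]
    by (intro Bochner_Integration.integral_cong) simp_all
  also have "\<dots> = 2 * pi * (LINT x|lborel. poisson_dd d x * f x)"
    by (rule integral_mult_right_zero)
  finally show ?thesis by simp
qed

text \<open>Adding the quadratic Taylor term leaves a remainder \<open>E\<close> that two mean value
  steps and the Lipschitz bound on \<open>f2\<close> show to be O(|t|^3).\<close>

lemma D2f_limit: "((\<lambda>t. D2 f 0 t / t\<^sup>2) \<longlongrightarrow> - f2 0) (at 0)"
proof -
  define E where "E t = D2 f 0 t + f2 0 * t\<^sup>2" for t
  define E1 where "E1 t = f1 (- t) - f1 t + 2 * f2 0 * t" for t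
  have E: "(E has_real_derivative E1 t) (at t)" for t
    unfolding E_def E1_def D2_def by (auto intro!: derivative_eq_intros DERIV_chain'[OF _ der0, THEN DERIV_cong])
  have E1: "(E1 has_real_derivative 2 * f2 0 - f2 (- t) - f2 t) (at t)" for t
    unfolding E1_def by (auto intro!: derivative_eq_intros DERIV_chain'[OF _ der1, THEN DERIV_cong])
  have b1: "\<bar>E1 t\<bar> \<le> 2 * M * t\<^sup>2" if t: "0 < t" for t
  proof -
    obtain z where z: "0 < z" "z < t" "E1 t - E1 0 = (t - 0) * (2 * f2 0 - f2 (- z) - f2 z)"
      using MVT2[OF t E1] by auto
    have "\<bar>2 * f2 0 - f2 (- z) - f2 z\<bar> \<le> M * z + M * z"
      using lip2[of 0 z] lip2[of 0 "-z"] z(1) by simp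
    also have "\<dots> \<le> 2 * M * t" using z M_nonneg by (simp add: mult_left_mono)
    finally have "\<bar>t * (2 * f2 0 - f2 (- z) - f2 z)\<bar> \<le> t * (2 * M * t)"
      using t by (simp add: abs_mult mult_left_mono)
    moreover have "E1 t = t * (2 * f2 0 - f2 (- z) - f2 z)" using z(3) by (simp add: E1_def)
    ultimately show ?thesis by (simp add: power2_eq_square mult_ac)
  qed
  have b: "\<bar>E t\<bar> \<le> 2 * M * \<bar>t\<bar> * t\<^sup>2" for t
  proof -
    have pos: "\<bar>E t\<bar> \<le> 2 * M * t * t\<^sup>2" if t: "0 < t" for t
    proof -
      obtain z where z: "0 < z" "z < t" "E t - E 0 = (t - 0) * E1 z"
        using MVT2[OF t E] by auto
      have "\<bar>E1 z\<bar> \<le> 2 * M * t\<^sup>2"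
        using b1[OF z(1)] mult_left_mono[OF power_mono[of z t 2], of "2 * M"] z M_nonneg by simp
      then have "\<bar>t * E1 z\<bar> \<le> t * (2 * M * t\<^sup>2)" using t by (simp add: abs_mult mult_left_mono)
      moreover have "E t = t * E1 z" using z(3) by (simp add: E_def D2_def)
      ultimately show ?thesis by (simp add: mult_ac)
    qed
    consider "0 < t" | "t = 0" | "0 < - t" by linarith
    then show ?thesis
    proof cases
      case 3
      then show ?thesis using pos[of "-t"] by (simp add: E_def)
    qed (use pos[of t] in \<open>auto simp: E_def D2_def\<close>)
  qed
  have "((\<lambda>t. E t / t\<^sup>2) \<longlongrightarrow> 0) (at 0)"
  proof (rule tendsto_0_le[of "\<lambda>t. 2 * M * t" _ _ 1])
    show "((\<lambda>t. 2 * M * t) \<longlongrightarrow> 0) (at 0)" by (auto intro!: tendsto_eq_intros)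
    show "\<forall>\<^sub>F t in at 0. norm (E t / t\<^sup>2) \<le> norm (2 * M * t) * 1"
      using b M_nonneg by (intro eventually_at_filter[THEN iffD2] always_eventually) (auto simp: abs_divide abs_mult divide_le_eq)
  qed
  then have "((\<lambda>t. E t / t\<^sup>2 - f2 0) \<longlongrightarrow> 0 - f2 0) (at 0)" by (intro tendsto_intros)
  moreover have "\<forall>\<^sub>F t in at 0. E t / t\<^sup>2 - f2 0 = D2 f 0 t / t\<^sup>2"
    by (intro eventually_at_filter[THEN iffD2] always_eventually) (auto simp: E_def add_divide_distrib)
  ultimately show ?thesis by (simp add: tendsto_cong)
qed

end

section \<open>The second derivative of the Poisson kernel as approximate second derivative at
  0\<close>

lemma poisson_dd_scaled:
  assumes "0 < d"
  shows "poisson_dd d (d * u) = poisson_dd 1 u / d ^ 3"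
proof -
  have "poisson d (d * u) = weight u / d" "cpoisson d (d * u) = cpoisson 1 u / d"
  proof -
    have "(d * u)\<^sup>2 + d\<^sup>2 = d\<^sup>2 * (1 + u\<^sup>2)" by (simp add: algebra_simps power_mult_distrib)
    then show "poisson d (d * u) = weight u / d" "cpoisson d (d * u) = cpoisson 1 u / d"
      using assms by (simp_all add: poisson_def[of d] cpoisson_def weight_eq power2_eq_square add.commute)
  qed
  then show ?thesis
    by (simp add: poisson_dd_def power_divide power2_eq_square power3_eq_cube diff_divide_distrib)
qed

lemma abs_square_poisson_dd: "\<bar>poisson_dd 1 u * u\<^sup>2\<bar> \<le> 6 * weight u"
proof -
  have "\<bar>poisson_dd 1 u * u\<^sup>2\<bar> \<le> 6 * (weight u)\<^sup>2 * u\<^sup>2"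
    unfolding abs_mult using abs_poisson_dd[of 1 u] by (simp add: mult_right_mono)
  also have "\<dots> = 6 * weight u * (weight u * u\<^sup>2)" by (simp add: power2_eq_square)
  also have "\<dots> \<le> 6 * weight u * 1"
  proof (rule mult_left_mono)
    show "weight u * u\<^sup>2 \<le> 1" by (simp add: weight_eq divide_le_eq add_pos_nonneg)
  qed (simp add: less_imp_le[OF weight_pos])
  finally show ?thesis by simp
qed

lemma integral_square_poisson_dd: "(LINT u|lborel. poisson_dd 1 u * u\<^sup>2) = 2 * pi"
proof -
  \<comment> \<open>Two integrations by parts against u^2. The first two terms vanish at both ends,
    and the arctangent supplies twice the mass pi of \<open>weight\<close>.\<close>
  define F where "F u = u\<^sup>2 * im_kernel 1 u - 2 * u * weight u + 2 * arctan u" for u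
  have "(LINT u|lborel. poisson_dd 1 u * u\<^sup>2) = pi - (- pi)"
  proof (rule integral_FTC_UNIV[of F])
    show "(F has_vector_derivative poisson_dd 1 u * u\<^sup>2) (at u)" for u
      unfolding has_real_derivative_iff_has_vector_derivative[symmetric] F_def
      by (rule derivative_eq_intros refl DERIV_im_kernel DERIV_poisson zero_less_one)+
         (simp add: weight_eq inverse_eq_divide algebra_simps)
    show "continuous_on UNIV (\<lambda>u. poisson_dd 1 u * u\<^sup>2)"
      by (intro continuous_intros cont_kernels) simp
    show "integrable lborel (\<lambda>u. poisson_dd 1 u * u\<^sup>2)"
      by (rule Bochner_Integration.integrable_bound[OF integrable_mult_right[OF integrable_weight, of 6]])
         (use order_trans[OF abs_square_poisson_dd abs_ge_self] in auto)
    have "((\<lambda>u. u\<^sup>2 * im_kernel 1 u - 2 * u * weight u) \<longlongrightarrow> 0) at_top" "((\<lambda>u. u\<^sup>2 * im_kernel 1 u - 2 * u * weight u) \<longlongrightarrow> 0) at_bot"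
      unfolding im_kernel_def cpoisson_def poisson_def by real_asymp+
    from tendsto_add[OF this(1) tendsto_mult[OF tendsto_const[of 2] tendsto_arctan_at_top]]
      tendsto_add[OF this(2) tendsto_mult[OF tendsto_const[of 2] tendsto_arctan_at_bot]]
    show "(F \<longlongrightarrow> - pi) at_bot" "(F \<longlongrightarrow> pi) at_top"
      by (simp_all add: F_def[abs_def])
  qed
  then show ?thesis by simp
qed

context C3b begin

text \<open>Evenness and zero mean replace \<open>f\<close> by \<open>D2 f 0\<close>; after scaling
  this is asymptotic to - f''(0) u^2. The second moment 2 pi and the factor -1/2 then give pi
  f''(0).\<close>

lemma tendsto_integral_poisson_dd:
  assumes d: "\<And>n. 0 < d n" "d \<longlonglongrightarrow> 0"
  shows "(\<lambda>n. LINT x|lborel. poisson_dd (d n) x * f x) \<longlonglongrightarrow> pi * f2 0"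
proof -
  have "(LINT x|lborel. poisson_dd (d n) x * f x) = - (LINT u|lborel. poisson_dd 1 u * (D2 f 0 (d n * u) / (d n)\<^sup>2)) / 2" for n
  proof -
    have "(LINT x|lborel. poisson_dd (d n) x * f x) = - (LINT x|lborel. poisson_dd (d n) x * D2 f 0 x) / 2"
      by (rule integral_even_D2[OF integrable_poisson_dd[OF d(1)] integral_poisson_dd[OF d(1)] _ meas(1) bd0])
         (simp add: poisson_dd_def cpoisson_def poisson_def)
    also have "(LINT x|lborel. poisson_dd (d n) x * D2 f 0 x) = d n * (LINT u|lborel. poisson_dd (d n) (d n * u) * D2 f 0 (d n * u))"
      using lborel_integral_real_affine[of "d n" "\<lambda>x. poisson_dd (d n) x * D2 f 0 x" 0] d(1)[of n] by simp
    also have "\<dots> = (LINT u|lborel. d n * (poisson_dd (d n) (d n * u) * D2 f 0 (d n * u)))" by simp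
    also have "\<dots> = (LINT u|lborel. poisson_dd 1 u * (D2 f 0 (d n * u) / (d n)\<^sup>2))"
      using d(1)[of n] by (intro Bochner_Integration.integral_cong) (simp_all add: poisson_dd_scaled power2_eq_square power3_eq_cube)
    finally show ?thesis .
  qed
  moreover have "(\<lambda>n. LINT u|lborel. poisson_dd 1 u * (D2 f 0 (d n * u) / (d n)\<^sup>2)) \<longlonglongrightarrow> (LINT u|lborel. - f2 0 * (poisson_dd 1 u * u\<^sup>2))"
  proof (rule integral_dominated_convergence[where w="\<lambda>u. 12 * M * weight u"])
    show "AE u in lborel. (\<lambda>n. poisson_dd 1 u * (D2 f 0 (d n * u) / (d n)\<^sup>2)) \<longlonglongrightarrow> - f2 0 * (poisson_dd 1 u * u\<^sup>2)"
    proof (rule AE_I2)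
      fix u :: real
      show "(\<lambda>n. poisson_dd 1 u * (D2 f 0 (d n * u) / (d n)\<^sup>2)) \<longlonglongrightarrow> - f2 0 * (poisson_dd 1 u * u\<^sup>2)"
      proof (cases "u = 0")
        case False
        have "(\<lambda>n. d n * u) \<longlonglongrightarrow> 0 * u" using d(2) by (intro tendsto_intros)
        then have "filterlim (\<lambda>n. d n * u) (at 0) sequentially"
          using False d(1) by (auto simp: filterlim_at intro!: always_eventually)
             (metis less_irrefl)
        from filterlim_compose[OF D2f_limit this]
        have "(\<lambda>n. poisson_dd 1 u * u\<^sup>2 * (D2 f 0 (d n * u) / (d n * u)\<^sup>2)) \<longlonglongrightarrow> poisson_dd 1 u * u\<^sup>2 * (- f2 0)"
          by (intro tendsto_intros)
        then show ?thesis using False by (simp add: power_mult_distrib mult_ac)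
      qed (simp add: D2_def)
    qed
    show "AE u in lborel. norm (poisson_dd 1 u * (D2 f 0 (d n * u) / (d n)\<^sup>2)) \<le> 12 * M * weight u" for n
    proof (rule AE_I2)
      fix u
      have "\<bar>D2 f 0 (d n * u) / (d n)\<^sup>2\<bar> \<le> 2 * M * u\<^sup>2"
        using D2f[of 0 "d n * u"] d(1)[of n] by (simp add: abs_divide divide_le_eq power_mult_distrib mult_ac)
      then have "\<bar>poisson_dd 1 u\<bar> * \<bar>D2 f 0 (d n * u) / (d n)\<^sup>2\<bar> \<le> \<bar>poisson_dd 1 u\<bar> * (2 * M * u\<^sup>2)"
        by (rule mult_left_mono) simp
      also have "\<dots> = 2 * M * \<bar>poisson_dd 1 u * u\<^sup>2\<bar>" by (simp add: abs_mult)
      also have "\<dots> \<le> 2 * M * (6 * weight u)" using M_nonneg by (intro mult_left_mono abs_square_poisson_dd) auto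
      finally show "norm (poisson_dd 1 u * (D2 f 0 (d n * u) / (d n)\<^sup>2)) \<le> 12 * M * weight u" by (simp add: abs_mult)
    qed
  qed (use integrable_weight in \<open>auto simp: D2_def\<close>)
  ultimately have "(\<lambda>n. LINT x|lborel. poisson_dd (d n) x * f x) \<longlonglongrightarrow> - (LINT u|lborel. - f2 0 * (poisson_dd 1 u * u\<^sup>2)) / 2"
    by (simp only:) (intro tendsto_intros, auto)
  then show ?thesis unfolding integral_mult_right_zero integral_square_poisson_dd by (simp add: mult.commute)
qed

text \<open>Two evaluations of the limit of the integral of \<open>re_kernel d * L\<close>:
  \<open>integral_even_D2\<close> gives - pi \<Lambda>L(0), using |re_kernel d x| \<le> 1/x^2 and
  \<open>integrable_D2L\<close>; the transfer to the kernel gives pi f''(0).\<close>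

lemma LamI_L: "LamI L 0 = - f2 0"
proof -
  define d where "d n = inverse (real (Suc n))" for n
  have d: "0 < d n" "d \<longlonglongrightarrow> 0" for n
    unfolding d_def using LIMSEQ_inverse_real_of_nat by simp_all
  have "(\<lambda>n. LINT x|lborel. re_kernel (d n) x * D2 L 0 x) \<longlonglongrightarrow> (LINT x|lborel. D2 L 0 x / x\<^sup>2)"
  proof (rule integral_dominated_convergence[where w="\<lambda>x. \<bar>D2 L 0 x / x\<^sup>2\<bar>"])
    show "AE x in lborel. (\<lambda>n. re_kernel (d n) x * D2 L 0 x) \<longlonglongrightarrow> D2 L 0 x / x\<^sup>2"
    proof (rule AE_I2)
      fix x :: real
      show "(\<lambda>n. re_kernel (d n) x * D2 L 0 x) \<longlonglongrightarrow> D2 L 0 x / x\<^sup>2"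
      proof (cases "x = 0")
        case False
        have "(\<lambda>n. poisson (d n) x) \<longlonglongrightarrow> 0 / (x\<^sup>2 + 0\<^sup>2)"
          unfolding poisson_def using d(2) False by (intro tendsto_intros) auto
        then have "(\<lambda>n. ((cpoisson (d n) x)\<^sup>2 - (poisson (d n) x)\<^sup>2) * D2 L 0 x) \<longlonglongrightarrow> ((1 / x)\<^sup>2 - 0\<^sup>2) * D2 L 0 x"
          by (intro tendsto_intros tendsto_cpoisson[OF d(2)]) simp
        then show ?thesis by (simp add: re_kernel_def power_divide)
      qed (simp add: D2_def)
    qed
    show "AE x in lborel. norm (re_kernel (d n) x * D2 L 0 x) \<le> \<bar>D2 L 0 x / x\<^sup>2\<bar>" for n
    proof (rule AE_I2)
      fix x
      show "norm (re_kernel (d n) x * D2 L 0 x) \<le> \<bar>D2 L 0 x / x\<^sup>2\<bar>"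
      proof (cases "x = 0")
        case False
        have "\<bar>re_kernel (d n) x\<bar> \<le> poisson (d n) x / d n" by (rule abs_re_kernel[OF d(1)])
        also have "\<dots> \<le> 1 / x\<^sup>2"
          using False d(1)[of n] sum_squares_pos[OF d(1)[of n], of x] by (simp add: poisson_def frac_le)
        finally have "\<bar>re_kernel (d n) x\<bar> * \<bar>D2 L 0 x\<bar> \<le> 1 / x\<^sup>2 * \<bar>D2 L 0 x\<bar>" by (rule mult_right_mono) simp
        then show ?thesis by (simp add: abs_mult abs_divide)
      qed (simp add: D2_def)
    qed
  qed (use integrable_abs[OF integrable_D2L] in simp_all)
  then have "(\<lambda>n. - (LINT x|lborel. re_kernel (d n) x * D2 L 0 x) / 2) \<longlonglongrightarrow> - (LINT x|lborel. D2 L 0 x / x\<^sup>2) / 2"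
    by (intro tendsto_intros) auto
  moreover have "- (LINT x|lborel. re_kernel (d n) x * D2 L 0 x) / 2 = (LINT x|lborel. poisson_dd (d n) x * f x)" for n
    unfolding integral_re_kernel_L[OF d(1), symmetric]
    by (rule integral_even_D2[OF integrable_re_kernel[OF d(1)] integral_re_kernel[OF d(1)] _ measL bdL, symmetric])
       (simp add: re_kernel_def cpoisson_def poisson_def)
  ultimately have "- (LINT x|lborel. D2 L 0 x / x\<^sup>2) / 2 = pi * f2 0"
    using LIMSEQ_unique[OF _ tendsto_integral_poisson_dd[OF d]] by simp
  then have "pi * (LamI L 0 + f2 0) = 0" unfolding integral_eq_LamI by (simp add: distrib_left)
  then show ?thesis by simp
qed


text \<open>With the prefactor 1/(2 pi), \<open>integral_N\<close> contributes 2/(2 pi) = 1/pi to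
  the seminorm term and pi/(2 pi) = 1/2 to each square.\<close>

lemma Lam_f_L: "Lam (\<lambda>x. f x * L x) 0 + f 0 * f2 0
    = 1 / 2 * (L 0)\<^sup>2 - 1 / 2 * (f1 0)\<^sup>2 - 1 / pi * (LINT x|lborel. g x * LamI g x)"
proof -
  define F where "F x = f x * L x" for x
  have D2F: "D2 F 0 t / t\<^sup>2 = f 0 * (D2 L 0 t / t\<^sup>2) - N t / t" for t
  proof (cases "t = 0")
    case False
    have f: "f t = f 0 + t * g t" "f (- t) = f 0 - t * g (- t)"
      using x_g[of t] x_g[of "-t"] by simp_all
    have "D2 F 0 t = 2 * f 0 * L 0 - f t * L t - f (- t) * L (- t)" by (simp add: D2_def F_def)
    also have "\<dots> = f 0 * D2 L 0 t - t * N t"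
      unfolding f by (simp add: D2_def N_def algebra_simps)
    finally have "D2 F 0 t = f 0 * D2 L 0 t - t * N t" .
    then show ?thesis using False by (simp add: diff_divide_distrib power2_eq_square)
  qed (simp add: D2_def)
  have "Lam F 0 = LamI F 0"
  proof (rule Lam_eq_LamI)
    show "(F has_real_derivative f1 x * L x + f x * L1 x) (at x)" for x
      unfolding F_def by (rule derivative_eq_intros refl der0 derL)+ simp
    show "continuous_on UNIV (\<lambda>x. f1 x * L x + f x * L1 x)"
      by (intro continuous_intros cont0 cont1 contL contL1)
    show "\<bar>F x\<bar> \<le> M * (3 * M)" for x
      unfolding F_def abs_mult using M_nonneg by (intro mult_mono bd0 bdL) auto
    \<comment> \<open>A bound on the second difference of the product is not at hand, since
      \<open>L\<close> has no second-derivative bound here; integrability at 0 comes from the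
      splitting.\<close>
    show "integrable lborel (\<lambda>t. D2 F 0 t / t\<^sup>2)"
      unfolding D2F by (intro Bochner_Integration.integrable_diff integrable_mult_right integrable_D2L integrable_N)
  qed
  also have "\<dots> = 1 / (2 * pi) * (f 0 * (2 * pi * LamI L 0) - (LINT x|lborel. N x / x))"
    unfolding LamI_def[of F] D2F Bochner_Integration.integral_diff[OF integrable_mult_right[OF integrable_D2L] integrable_N]
      integral_mult_right_zero integral_eq_LamI ..
  also have "\<dots> = - f 0 * f2 0 - 1 / pi * (LINT x|lborel. g x * LamI g x) + 1 / 2 * (L 0)\<^sup>2 - 1 / 2 * (f1 0)\<^sup>2"
    unfolding LamI_L integral_N by (simp add: field_simps)
  finally show ?thesis by (simp add: F_def[abs_def])
qed

lemma hdot_half_g: "(hdot_half g)\<^sup>2 = (LINT x|lborel. g x * LamI g x)"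
  unfolding hdot_half_def Lam_g using integral_g_LamI_g_nonneg by simp

end

section \<open>From the class \<open>Cb 3\<close> to the locale\<close>

lemma Cb_3_imp_C3b:
  assumes "Cb 3 f"
  obtains M where "C3b f (deriv f) ((deriv ^^ 2) f) ((deriv ^^ 3) f) M"
proof -
  have "\<exists>B. \<forall>x. \<bar>(deriv ^^ j) f x\<bar> \<le> B" if "j \<le> 3" for j
    using assms that unfolding Cb_def bounded_iff by auto
  then obtain B where B: "\<And>j x. j \<le> 3 \<Longrightarrow> \<bar>(deriv ^^ j) f x\<bar> \<le> B j" by metis
  define M where "M = Max (B ` {..3})"
  have M: "\<bar>(deriv ^^ j) f x\<bar> \<le> M" if "j \<le> 3" for j x
    unfolding M_def using that by (intro order_trans[OF B[OF that] Max_ge]) auto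
  have D: "((deriv ^^ j) f has_real_derivative (deriv ^^ Suc j) f x) (at x)" if "j < 3" for j x
    using assms that by (simp add: Cb_def DERIV_deriv_iff_real_differentiable)
  have "C3b f (deriv f) ((deriv ^^ 2) f) ((deriv ^^ 3) f) M"
    using D[of 0] D[of 1] D[of 2] M[of 0] M[of 1] M[of 2] M[of 3]
    by unfold_locales (simp_all add: eval_nat_numeral)
  then show thesis by (rule that)
qed

theorem proposition3p5:
  fixes f :: "real \<Rightarrow> real"
  assumes "Cb 3 f"
  shows "Lam (\<lambda>x. f x * Lam f x) 0 + f 0 * (deriv ^^ 2) f 0
       = 1 / 2 * (Lam f 0)\<^sup>2 - 1 / 2 * (deriv f 0)\<^sup>2
         - 1 / pi * (hdot_half (diffquot f))\<^sup>2"
proof -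
  obtain M where "C3b f (deriv f) ((deriv ^^ 2) f) ((deriv ^^ 3) f) M"
    using Cb_3_imp_C3b[OF assms] .
  then interpret C3b f "deriv f" "(deriv ^^ 2) f" "(deriv ^^ 3) f" M .
  show ?thesis
    using Lam_f_L unfolding Lam_f hdot_half_g .
qed

end
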